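(* Let $1<q<\infty$ and let $\overline{M}_q$ be the vector-valued extension of the Hardy–Littlewood maximal operator $M$ on $\mathbb{R}^n$. Then there are constants $\alpha,c>0$ such that for every cube $Q$ and every vector function $f=\{f_j\}_{j=1}^\infty$ of locally integrable functions with $\operatorname{supp}f_j\subseteq Q$ for all $j$, $$|\{x\in Q: \overline{M}_qf(x)>t\,M(|f|_q)(x)\}|\le c\,e^{-\alpha t^q}|Q|,\qquad t>0.$$
   Context: Cubes have sides parallel to the axes. The Hardy–Littlewood maximal operator is $Mg(x)=\sup_{Q\ni x}\frac1{|Q|}\int_Q|g(y)|\,dy$, the supremum over all cubes $Q$ containing $x$. For $f=\{f_j\}_{j=1}^\infty$, $|f(x)|_q=\big(\sum_{j=1}^\infty|f_j(x)|^q\big)^{1/q}$ and $\overline{M}_qf(x)=\big(\sum_{j=1}^\infty(Mf_j(x))^q\big)^{1/q}$. *)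

theory Defs
  imports "HOL-Analysis.Analysis"
begin

text \<open>Cubes are closed and nondegenerate. Open or half-open cubes would give the same
  maximal function.\<close>

definition is_cube :: "(real ^ 'n) set \<Rightarrow> bool" where
  "is_cube Q \<longleftrightarrow> (\<exists>a l. 0 < l \<and> Q = cbox a (\<chi> i. a $ i + l))"

definition locally_integrable :: "(real ^ 'n \<Rightarrow> real) \<Rightarrow> bool" where
  "locally_integrable g \<longleftrightarrow> (\<forall>K. compact K \<longrightarrow> set_integrable lebesgue K g)"

text \<open>The maximal operator acts on \<open>g \<ge> 0\<close> with values in \<open>[0, \<infinity>]\<close>, because it is also applied
  to \<open>|f|\<^sub>q\<close>, which may be infinite at some points. For a real-valued \<open>g\<close>, the maximal
  function of \<open>g\<close> is \<open>hl_maximal (\<lambda>y. ennreal \<bar>g y\<bar>)\<close>.\<close>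

definition hl_maximal :: "(real ^ 'n \<Rightarrow> ennreal) \<Rightarrow> real ^ 'n \<Rightarrow> ennreal" where
  "hl_maximal g x =
     (SUP Q \<in> {Q. is_cube Q \<and> x \<in> Q}. (\<integral>\<^sup>+ y\<in>Q. g y \<partial>lebesgue) / emeasure lebesgue Q)"

text \<open>Real powers on \<open>[0, \<infinity>]\<close>, used for positive exponents only.\<close>

definition ennreal_powr :: "ennreal \<Rightarrow> real \<Rightarrow> ennreal" where
  "ennreal_powr u p = (if u = \<infinity> then \<infinity> else ennreal (enn2real u powr p))"

definition lq_norm :: "real \<Rightarrow> (nat \<Rightarrow> ennreal) \<Rightarrow> ennreal" where
  "lq_norm q u = ennreal_powr (\<Sum>j. ennreal_powr (u j) q) (1 / q)"

text \<open>\<open>|f(x)|\<^sub>q\<close>\<close>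

definition vec_abs :: "real \<Rightarrow> (nat \<Rightarrow> real ^ 'n \<Rightarrow> real) \<Rightarrow> real ^ 'n \<Rightarrow> ennreal" where
  "vec_abs q f x = lq_norm q (\<lambda>j. ennreal \<bar>f j x\<bar>)"

definition vec_maximal :: "real \<Rightarrow> (nat \<Rightarrow> real ^ 'n \<Rightarrow> real) \<Rightarrow> real ^ 'n \<Rightarrow> ennreal" where
  "vec_maximal q f x = lq_norm q (\<lambda>j. hl_maximal (\<lambda>y. ennreal \<bar>f j y\<bar>) x)"

end

theory Submission
  imports Defs
begin

text \<open>The averages of the \<open>|f\<^sub>j|\<close> over the dyadic cells that shrink to a point form a martingale
\<open>x = (x\<^sub>j)\<close> on a tree, and by Minkowski's inequality its \<open>\<ell>\<^sup>q\<close> norm is at most the average \<open>g\<close> of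
\<open>|f|\<^sub>q\<close>. Let \<open>m\<^sub>j\<close> and \<open>G\<close> be the running maxima of \<open>x\<^sub>j\<close> and \<open>g\<close> along a branch, and let
\<open>S = \<Sum>\<^sub>j m\<^sub>j\<^sup>q\<close>. For dyadic maximal functions the claim is that \<open>S / G\<^sup>q\<close> has an exponential moment.
This ratio is dominated by the increasing process \<open>A\<close> whose increments are those of \<open>S\<close>, each
divided by the value that \<open>G\<^sup>q\<close> had just before. Two facts about \<open>A\<close> give the moment.

The expected growth of \<open>A\<close> below any node is bounded by a constant that depends neither on the depth
of the tree nor on the number of functions (\<open>local_mean_le\<close>). Restarting the maxima \<open>m\<^sub>j\<close> at the
node makes the increments of \<open>S\<close> only larger. For the restarted maxima, Doob's inequality in the one-step
form \<open>m'\<^sup>q - m\<^sup>q \<le> p (m'\<^sup>q\<^sup>-\<^sup>1 - m\<^sup>q\<^sup>-\<^sup>1) x'\<close> with \<open>p = q / (q - 1)\<close> (\<open>powr_max_diff_le\<close>) shows that the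
increments of \<open>A\<close> are at most those of the potential
\<open>(2 p \<Sum>\<^sub>j m\<^sub>j\<^sup>q\<^sup>-\<^sup>1 x\<^sub>j - S) / G\<^sup>q - C g / G\<close>, up to martingale differences. This potential is bounded
above by a constant everywhere and bounded below by a constant at the node, and the sum telescopes. Its last term pays for
the growth of \<open>G\<close>; here the doubling property of cells is used, through \<open>g(child) \<le> 2\<^sup>n g(parent)\<close>.

An increasing process on a tree whose expected remaining growth is bounded at every node has an
exponential moment (\<open>john_nirenberg_tree\<close>). Chebyshev's inequality then bounds the proportion of
leaves with \<open>S > T G\<^sup>q\<close> by a multiple of \<open>exp (- T / (2 \<kappa>))\<close>, and \<open>T\<close> is comparable to \<open>t\<^sup>q\<close>.

To pass from cubes to cells, let \<open>Q\<close> have side \<open>l\<close> and consider the \<open>2\<^sup>n\<close> dyadic trees whose roots have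
side \<open>3 l\<close> and are translated by \<open>0\<close> or \<open>- l\<close> in each coordinate. The trace on \<open>Q\<close> of any cube that meets
\<open>Q\<close> lies in a cell of one of these trees whose side is at most six times that of the cube
(\<open>cube_in_shifted_cell\<close>), so
\<open>M f\<^sub>j \<le> 6\<^sup>n max\<^sub>s M\<^sub>s f\<^sub>j\<close> on \<open>Q\<close>, where \<open>M\<^sub>s\<close> is the dyadic maximal operator of the tree \<open>s\<close>. The level
sets for finitely many functions and finite depth, taken relative to the full maximal function
\<open>M(|f|\<^sub>q)\<close>, increase to the ones for all functions and all depths. Finally, if \<open>|f|\<^sub>q\<close> is not
integrable, then \<open>M(|f|\<^sub>q) = \<infinity>\<close> on \<open>Q\<close>, and the level set is empty.\<close>

section \<open>Exponential integrability on trees\<close>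

text \<open>Words are the nodes of a complete tree: the children of \<open>w\<close> are the words \<open>e # w\<close>, so that a word
spells its path from the root \<open>[]\<close> backwards, and \<open>u @ w\<close> is a descendant of \<open>w\<close>. The mean is
taken over the leaves at depth \<open>N\<close>.\<close>
definition word_mean :: "nat \<Rightarrow> ('e::finite list \<Rightarrow> real) \<Rightarrow> real" where
  "word_mean N \<phi> = (\<Sum>u | length u = N. \<phi> u) / real CARD('e) ^ N"

lemma finite_words: "finite {u :: 'e::finite list. length u = N}"
  using finite_lists_length_eq[of "UNIV :: 'e set" N] by simp

lemma card_words: "card {u :: 'e::finite list. length u = N} = CARD('e) ^ N"
  using card_lists_length_eq[of "UNIV :: 'e set" N] by simp

lemma sum_words_Suc_Cons:
  fixes \<phi> :: "'e::finite list \<Rightarrow> 'a::comm_monoid_add"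
  shows "(\<Sum>u | length u = Suc N. \<phi> u) = (\<Sum>u | length u = N. \<Sum>e\<in>UNIV. \<phi> (e # u))"
proof -
  have "(\<Sum>u | length u = N. \<Sum>e\<in>UNIV. \<phi> (e # u))
    = (\<Sum>(u, e)\<in>{u. length u = N} \<times> UNIV. \<phi> (e # u))"
    by (simp add: sum.cartesian_product)
  also have "\<dots> = (\<Sum>u | length u = Suc N. \<phi> u)"
    by (rule sum.reindex_bij_witness[where i = "\<lambda>u. (tl u, hd u)" and j = "\<lambda>(u, e). e # u"])
      (auto simp: length_Suc_conv)
  finally show ?thesis ..
qed

lemma sum_words_Suc_snoc:
  fixes \<phi> :: "'e::finite list \<Rightarrow> 'a::comm_monoid_add"
  shows "(\<Sum>u | length u = Suc N. \<phi> u) = (\<Sum>e\<in>UNIV. \<Sum>u | length u = N. \<phi> (u @ [e]))"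
proof -
  have "(\<Sum>e\<in>UNIV. \<Sum>u | length u = N. \<phi> (u @ [e]))
    = (\<Sum>(e, u)\<in>UNIV \<times> {u. length u = N}. \<phi> (u @ [e]))"
    by (simp add: sum.cartesian_product)
  also have "\<dots> = (\<Sum>u | length u = Suc N. \<phi> u)"
    by (rule sum.reindex_bij_witness[where i = "\<lambda>u. (last u, butlast u)" and j = "\<lambda>(e, u). u @ [e]"])
      (auto simp: length_Suc_conv_rev)
  finally show ?thesis ..
qed

lemma word_mean_0 [simp]: "word_mean 0 \<phi> = \<phi> []"
  by (simp add: word_mean_def)

text \<open>A mean over leaves can be computed by averaging over the last step first or over the first step
first. The first form serves for telescoping along branches, the second for recursion into the
subtrees of the root.\<close>
lemma word_mean_Suc_Cons:
  "word_mean (Suc N) \<phi> = word_mean N (\<lambda>u :: 'e::finite list. (\<Sum>e\<in>UNIV. \<phi> (e # u)) / real CARD('e))"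
  by (simp add: word_mean_def sum_words_Suc_Cons sum_divide_distrib mult.commute)

lemma word_mean_Suc_snoc:
  "word_mean (Suc N) \<phi> = (\<Sum>e\<in>UNIV. word_mean N (\<lambda>u. \<phi> (u @ [e :: 'e::finite]))) / real CARD('e)"
  by (simp add: word_mean_def sum_words_Suc_snoc sum_divide_distrib mult.commute)

lemma word_mean_mono: "(\<And>u. \<phi> u \<le> \<psi> u) \<Longrightarrow> word_mean N \<phi> \<le> word_mean N \<psi>"
  unfolding word_mean_def by (intro divide_right_mono sum_mono) auto

lemma word_mean_add: "word_mean N (\<lambda>u. \<phi> u + \<psi> u) = word_mean N \<phi> + word_mean N \<psi>"
  by (simp add: word_mean_def sum.distrib add_divide_distrib)

lemma word_mean_cmult: "word_mean N (\<lambda>u. c * \<phi> u) = c * word_mean N \<phi>"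
  by (simp add: word_mean_def sum_distrib_left)

lemma word_mean_const [simp]: "word_mean N (\<lambda>u :: 'e::finite list. c) = c"
  by (simp add: word_mean_def card_words)

text \<open>The sum runs along the path from the node \<open>w\<close>, which is included, to its descendant \<open>u @ w\<close>.\<close>
primrec path_sum :: "('e list \<Rightarrow> real) \<Rightarrow> 'e list \<Rightarrow> 'e list \<Rightarrow> real" where
  "path_sum \<delta> w [] = \<delta> w"
| "path_sum \<delta> w (e # u) = \<delta> (e # u @ w) + path_sum \<delta> w u"

lemma path_sum_snoc: "path_sum \<delta> w (u @ [e]) = \<delta> w + path_sum \<delta> (e # w) u"
  by (induction u) auto

lemma path_sum_nonneg: "(\<And>v. 0 \<le> \<delta> v) \<Longrightarrow> 0 \<le> path_sum \<delta> w u"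
  by (induction u) auto

text \<open>The bound is an affine function of the mean, so it survives averaging over the children of the
root. The induction on the depth therefore only has to absorb the value of \<open>\<delta>\<close> at the root, which is
the scalar inequality \<open>exp (\<beta> d) (1 + \<gamma> r) \<le> 1 + \<gamma> (d + r)\<close> for \<open>d + r \<le> \<kappa>\<close>.\<close>
lemma john_nirenberg_tree:
  fixes \<delta> :: "'e::finite list \<Rightarrow> real"
  assumes \<delta>: "\<And>v. 0 \<le> \<delta> v"
    and le: "\<And>w N. word_mean N (path_sum \<delta> w) \<le> \<kappa>"
    and \<beta>: "0 < \<beta>" "\<beta> * \<kappa> < 1"
  shows "word_mean N (\<lambda>u. exp (\<beta> * path_sum \<delta> w u))
    \<le> 1 + \<beta> / (1 - \<beta> * \<kappa>) * word_mean N (path_sum \<delta> w)"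
proof -
  define \<gamma> where "\<gamma> = \<beta> / (1 - \<beta> * \<kappa>)"
  have \<gamma>: "0 < \<gamma>" "\<gamma> - \<gamma> * (\<beta> * \<kappa>) = \<beta>"
    using \<beta> unfolding \<gamma>_def
    by (simp, metis diff_gt_0_iff_gt less_numeral_extra(3) mult.right_neutral nonzero_eq_divide_eq right_diff_distrib)
  \<comment> \<open>This uses \<open>exp z \<le> 1 / (1 - z)\<close> and the choice of \<open>\<gamma>\<close>, which makes \<open>\<gamma> (1 - \<beta> \<kappa>) = \<beta>\<close>.\<close>
  have step: "exp (\<beta> * d) * (1 + \<gamma> * r) \<le> 1 + \<gamma> * (d + r)"
    if "0 \<le> d" "0 \<le> r" "d + r \<le> \<kappa>" for d r
  proof -
    have "\<beta> * d \<le> \<beta> * \<kappa>" using that \<beta> by (intro mult_left_mono) auto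
    then have d: "0 < 1 - \<beta> * d" using \<beta> by linarith
    have "exp (\<beta> * d) \<le> 1 / (1 - \<beta> * d)"
      using exp_ge_add_one_self[of "- (\<beta> * d)"] d by (simp add: exp_minus field_simps)
    moreover have "1 + \<gamma> * r \<le> (1 + \<gamma> * (d + r)) * (1 - \<beta> * d)"
    proof -
      have "\<gamma> * (\<beta> * (d + r)) \<le> \<gamma> * (\<beta> * \<kappa>)" using that \<gamma> \<beta> by simp
      then have "0 \<le> \<gamma> - \<beta> - \<gamma> * (\<beta> * (d + r))" using \<gamma> by linarith
      then have "0 \<le> d * (\<gamma> - \<beta> - \<gamma> * (\<beta> * (d + r)))" using that by simp
      then show ?thesis by (simp add: algebra_simps)
    qed
    ultimately have "exp (\<beta> * d) * (1 + \<gamma> * r)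
      \<le> 1 / (1 - \<beta> * d) * ((1 + \<gamma> * (d + r)) * (1 - \<beta> * d))"
      using d that \<gamma> by (intro mult_mono) auto
    then show ?thesis using d by simp
  qed
  have "word_mean N (\<lambda>u. exp (\<beta> * path_sum \<delta> w u)) \<le> 1 + \<gamma> * word_mean N (path_sum \<delta> w)"
  proof (induction N arbitrary: w)
    case 0
    show ?case using step[of "\<delta> w" 0] le[of 0 w] \<delta> by simp
  next
    case (Suc N)
    define r where "r = (\<Sum>e\<in>UNIV. word_mean N (path_sum \<delta> (e # w))) / real CARD('e)"
    have r: "word_mean (Suc N) (path_sum \<delta> w) = \<delta> w + r"
      by (simp add: word_mean_Suc_snoc path_sum_snoc word_mean_add sum.distrib add_divide_distrib r_def)
    have "0 \<le> word_mean N (path_sum \<delta> v)" for v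
      using word_mean_mono[of "\<lambda>_. 0" "path_sum \<delta> v" N] path_sum_nonneg[of \<delta>] \<delta> by simp
    then have r0: "0 \<le> r" unfolding r_def by (intro divide_nonneg_nonneg sum_nonneg) auto
    have "word_mean (Suc N) (\<lambda>u. exp (\<beta> * path_sum \<delta> w u))
      = exp (\<beta> * \<delta> w) * ((\<Sum>e\<in>UNIV. word_mean N (\<lambda>u. exp (\<beta> * path_sum \<delta> (e # w) u))) / real CARD('e))"
      by (simp add: word_mean_Suc_snoc path_sum_snoc distrib_left exp_add word_mean_cmult sum_distrib_left)
    also have "\<dots> \<le> exp (\<beta> * \<delta> w) *
        ((\<Sum>e\<in>UNIV. 1 + \<gamma> * word_mean N (path_sum \<delta> (e # w))) / real CARD('e))"
      by (intro mult_left_mono divide_right_mono sum_mono Suc) auto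
    also have "\<dots> = exp (\<beta> * \<delta> w) * (1 + \<gamma> * r)"
      by (simp add: sum.distrib r_def sum_distrib_left add_divide_distrib)
    also have "\<dots> \<le> 1 + \<gamma> * (\<delta> w + r)"
      using step[of "\<delta> w" r] \<delta> r0 le[of "Suc N" w] r by simp
    finally show ?case by (simp add: r)
  qed
  then show ?thesis by (simp add: \<gamma>_def)
qed

section \<open>Running maxima and one-step inequalities\<close>

primrec running_max :: "('e list \<Rightarrow> real) \<Rightarrow> 'e list \<Rightarrow> real" where
  "running_max \<phi> [] = \<phi> []"
| "running_max \<phi> (e # w) = max (running_max \<phi> w) (\<phi> (e # w))"

lemma running_max_ge: "\<phi> w \<le> running_max \<phi> w"
  by (cases w) auto

lemma running_max_append:
  "running_max \<phi> (u @ w) = max (running_max \<phi> w) (running_max (\<lambda>v. \<phi> (v @ w)) u)"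
  by (induction u) (use running_max_ge[of \<phi> w] in auto)

lemma young_powr:
  fixes q m x :: real
  assumes "1 < q" "0 \<le> m" "0 \<le> x"
  shows "q * (m powr (q - 1) * x) \<le> (q - 1) * m powr q + x powr q"
proof -
  have "m powr (q - 1) * x \<le> (m powr (q - 1)) powr (q / (q - 1)) / (q / (q - 1)) + x powr q / q"
    by (rule Youngs_inequality) (use assms in \<open>auto simp: field_simps\<close>)
  also have "(m powr (q - 1)) powr (q / (q - 1)) = m powr q"
    using assms by (simp add: powr_powr)
  finally have "q * (m powr (q - 1) * x)
      \<le> q * (m powr q / (q / (q - 1)) + x powr q / q)"
    using assms by simp
  also have "\<dots> = (q - 1) * m powr q + x powr q" using assms by (simp add: field_simps)
  finally show ?thesis .
qed

text \<open>This is Doob's maximal inequality for a single step, in which a running maximum \<open>m\<close> meets the new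
value \<open>x\<close>. Only \<open>x > m\<close> needs an argument, and there it is Young's inequality. Its use is that
\<open>m powr (q - 1) * x\<close>, with the old \<open>m\<close>, differs by a martingale difference from the same product
with the old value of the martingale, so that the right-hand sides telescope on average.\<close>
lemma powr_max_diff_le:
  fixes q m x :: real
  assumes "1 < q" "0 \<le> m" "0 \<le> x"
  shows "max m x powr q - m powr q
    \<le> q / (q - 1) * ((max m x powr (q - 1) - m powr (q - 1)) * x)"
proof (cases "x \<le> m")
  case True then show ?thesis by (simp add: max_def)
next
  case False
  have "x powr (q - 1) * x = x powr q" using assms by (simp add: powr_mult_base mult.commute)
  moreover have "(q - 1) * (x powr q - m powr q) \<le> q * (x powr q - m powr (q - 1) * x)"
    using young_powr[OF assms] by (simp add: algebra_simps)
  ultimately show ?thesis using False assms by (simp add: max_def field_simps)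
qed

text \<open>The left-hand side is the relative change of \<open>G powr q\<close> when \<open>G\<close> grows by the factor \<open>r\<close>. An estimate
linear in \<open>r - 1\<close> is needed, because the growth of \<open>G\<close> is controlled on average only to first order.\<close>
lemma powr_minus_one_le:
  fixes q r B :: real
  assumes "1 < q" "1 \<le> r" "r \<le> B"
  shows "r powr q - 1 \<le> q * B powr (q - 1) * (r - 1)"
proof -
  have "r powr q - 1 \<le> q * r powr (q - 1) * (r - 1)"
    using young_powr[of q r 1] powr_mult_base[of r "q - 1"] assms by (simp add: algebra_simps)
  also have "\<dots> \<le> q * B powr (q - 1) * (r - 1)"
    using assms by (intro mult_right_mono mult_left_mono powr_mono2) auto
  finally show ?thesis .
qed

text \<open>Either \<open>c x \<le> m\<close>, and the first term on the right suffices, or \<open>m < c x\<close>, and the second one does.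
The coefficient \<open>1\<close> of \<open>m powr q\<close> is what lets the term \<open>- S\<close> in the potential cancel it.\<close>
lemma powr_absorb:
  fixes q m x c :: real
  assumes "1 < q" "0 \<le> m" "0 \<le> x" "0 < c"
  shows "c * (m powr (q - 1) * x) \<le> m powr q + c powr q * x powr q"
proof (cases "c * x \<le> m")
  case True
  have "m powr (q - 1) * (c * x) \<le> m powr (q - 1) * m" using True by (intro mult_left_mono) auto
  also have "\<dots> = m powr q" using assms by (simp add: powr_mult_base mult.commute)
  finally have "c * (m powr (q - 1) * x) \<le> m powr q" by (simp add: algebra_simps)
  moreover have "0 \<le> c powr q * x powr q" by simp
  ultimately show ?thesis by linarith
next
  case False
  have "m powr (q - 1) * (c * x) \<le> (c * x) powr (q - 1) * (c * x)"
    using False assms by (intro mult_right_mono powr_mono2) auto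
  also have "\<dots> = (c * x) powr q" using assms by (simp add: powr_mult_base mult.commute)
  also have "\<dots> = c powr q * x powr q" using assms by (simp add: powr_mult)
  finally have "c * (m powr (q - 1) * x) \<le> c powr q * x powr q" by (simp add: algebra_simps)
  moreover have "0 \<le> m powr q" by simp
  ultimately show ?thesis by linarith
qed

text \<open>Restarting a running maximum, that is, forgetting an earlier maximum \<open>c\<close>, does not decrease the
increments of its \<open>q\<close>-th power.\<close>
lemma powr_max_diff_mono:
  fixes q c m m' :: real
  assumes "0 \<le> q" "0 \<le> m" "m \<le> m'"
  shows "max c m' powr q - max c m powr q \<le> m' powr q - m powr q"
proof -
  have "m powr q \<le> m' powr q" using assms by (intro powr_mono2)
  moreover have "m powr q \<le> c powr q" if "m \<le> c" using that assms by (intro powr_mono2) auto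
  ultimately show ?thesis using assms by (auto simp: max_def)
qed


section \<open>Vector martingales on a tree\<close>

text \<open>An upper bound for the part \<open>(2 p \<Sum>\<^sub>j m\<^sub>j\<^sup>q\<^sup>-\<^sup>1 x\<^sub>j - S) / G\<^sup>q\<close> of the potential, where \<open>p = q / (q - 1)\<close>.\<close>
definition potential_bound :: "real \<Rightarrow> real" where
  "potential_bound q = (2 * (q / (q - 1))) powr q"

text \<open>The coefficient of \<open>g / G\<close> in the potential: what the growth of \<open>G\<close> may cost per unit of relative
growth on a tree with \<open>b\<close> children at each node.\<close>
definition growth_cost :: "real \<Rightarrow> real \<Rightarrow> real" where
  "growth_cost b q = potential_bound q * (q * b powr (q - 1))"

text \<open>The bound \<open>\<kappa>\<close> for the expected growth of \<open>A\<close> below a node: the increment at the node itself plus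
the oscillation of the potential.\<close>
definition tree_const :: "real \<Rightarrow> real \<Rightarrow> real" where
  "tree_const b q = b powr q + potential_bound q + growth_cost b q"

lemma tree_const_pos:
  assumes "1 < q" "0 < b"
  shows "0 < tree_const b q"
proof -
  have "0 < b powr q" "0 \<le> potential_bound q" "0 \<le> growth_cost b q"
    using assms by (auto simp: potential_bound_def growth_cost_def)
  then show ?thesis unfolding tree_const_def by linarith
qed

locale vector_martingale =
  fixes q :: real and J :: "'j set" and a :: "'j \<Rightarrow> 'e::finite list \<Rightarrow> real" and g :: "'e list \<Rightarrow> real"
  assumes q: "1 < q"
    and finite_J: "finite J"
    and a_nonneg: "\<And>j w. 0 \<le> a j w"
    and g_nonneg: "\<And>w. 0 \<le> g w"
    and g_root: "0 < g []"
    and a_average: "\<And>j w. (\<Sum>e\<in>UNIV. a j (e # w)) = real CARD('e) * a j w"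
    and g_average: "\<And>w. (\<Sum>e\<in>UNIV. g (e # w)) = real CARD('e) * g w"
    and minkowski: "\<And>w. (\<Sum>j\<in>J. a j w powr q) \<le> g w powr q"
begin

definition G :: "'e list \<Rightarrow> real" where "G = running_max g"

definition S :: "'e list \<Rightarrow> real" where "S w = (\<Sum>j\<in>J. running_max (a j) w powr q)"

text \<open>The increments of \<open>A\<close>. The denominator is the value of \<open>G\<close> at the parent, hence a common factor of
all siblings, so that martingale differences still average to zero after the division.\<close>
primrec \<delta> :: "'e list \<Rightarrow> real" where
  "\<delta> [] = S [] / G [] powr q"
| "\<delta> (e # w) = (S (e # w) - S w) / G w powr q"

lemma card_pos: "1 \<le> real CARD('e)"
  by (simp add: Suc_leI)

lemma G_Cons: "G (e # w) = max (G w) (g (e # w))"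
  by (simp add: G_def)

lemma g_le_G: "g w \<le> G w"
  by (simp add: G_def running_max_ge)

lemma G_pos: "0 < G w"
  by (induction w) (use g_root in \<open>auto simp: G_def\<close>)

lemma g_child_le: "g (e # w) \<le> real CARD('e) * g w"
  unfolding g_average[symmetric] by (rule member_le_sum) (auto simp: g_nonneg)

lemma G_child_le: "G (e # w) \<le> real CARD('e) * G w"
proof -
  have "1 * G w \<le> real CARD('e) * G w"
    using G_pos[of w] card_pos by (intro mult_right_mono) auto
  moreover have "g (e # w) \<le> real CARD('e) * G w"
    using g_child_le[of e w] mult_left_mono[OF g_le_G[of w], of "real CARD('e)"] by linarith
  ultimately show ?thesis by (simp add: G_Cons)
qed

lemma running_max_a_nonneg: "0 \<le> running_max (a j) w"
  using running_max_ge[of "a j" w] a_nonneg[of j w] by simp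

lemma S_nonneg: "0 \<le> S w"
  unfolding S_def by (intro sum_nonneg) simp

lemma S_mono: "S w \<le> S (e # w)"
  unfolding S_def using q running_max_a_nonneg by (intro sum_mono powr_mono2) auto

lemma \<delta>_nonneg: "0 \<le> \<delta> w"
  by (cases w) (auto simp: S_nonneg S_mono)

text \<open>Each step adds the increment of \<open>S\<close> over the old value of \<open>G powr q\<close> and then can only lower the
quotient, because \<open>G\<close> grows.\<close>
lemma S_le_path_sum: "S w / G w powr q \<le> path_sum \<delta> [] w"
proof (induction w)
  case Nil show ?case by simp
next
  case (Cons e w)
  have "S (e # w) / G (e # w) powr q \<le> S (e # w) / G w powr q"
    using q G_pos[of w] S_nonneg[of "e # w"]
    by (intro divide_left_mono powr_mono2 mult_pos_pos) (auto simp: G_Cons)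
  also have "\<dots> = S w / G w powr q + \<delta> (e # w)" by (simp add: diff_divide_distrib)
  finally show ?case using Cons by simp
qed

lemma sum_a_le_G: "(\<Sum>j\<in>J. a j w powr q) \<le> G w powr q"
  using minkowski[of w] powr_mono2[of q "g w" "G w"] q g_nonneg[of w] g_le_G[of w] by simp

text \<open>The increment of \<open>S\<close> is at most the sum of the new values \<open>a j w powr q\<close>, which is controlled by \<open>G\<close>
at the node; the value at the parent, in the denominator, is smaller by a factor of at most the number
of children.\<close>
lemma \<delta>_le: "\<delta> w \<le> real CARD('e) powr q"
proof (cases w)
  case Nil
  have "S [] \<le> G [] powr q" using sum_a_le_G[of "[]"] by (simp add: S_def)
  then have "\<delta> [] \<le> 1" using G_pos[of "[]"] by simp
  also have "1 \<le> real CARD('e) powr q" using card_pos q by (intro ge_one_powr_ge_zero) auto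
  finally show ?thesis using Nil by simp
next
  case (Cons e v)
  have "S w - S v \<le> (\<Sum>j\<in>J. a j w powr q)"
    unfolding S_def sum_subtractf[symmetric] Cons
    by (intro sum_mono) (use powr_ge_zero in \<open>auto simp: max_def\<close>)
  also have "\<dots> \<le> G w powr q" by (rule sum_a_le_G)
  also have "\<dots> \<le> (real CARD('e) * G v) powr q"
    unfolding Cons using q G_pos G_child_le by (intro powr_mono2) (auto simp: less_imp_le)
  also have "\<dots> = real CARD('e) powr q * G v powr q"
    using G_pos[of v] by (simp add: powr_mult)
  finally show ?thesis using G_pos[of v] Cons by (simp add: divide_le_eq)
qed

text \<open>The maxima \<open>m\<close> are restarted at \<open>w\<close>, while \<open>G\<close> keeps its history. The potential \<open>\<Psi>\<close> is bounded above
everywhere and below at \<open>w\<close>, and the increments of \<open>A\<close> are at most those of \<open>\<Psi>\<close> up to the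
martingale differences \<open>D\<close>. Without the restart, \<open>\<Psi>\<close> would have no lower bound at \<open>w\<close>, because
\<open>S / G powr q\<close> may already be large there.\<close>
lemma local_mean_le: "word_mean N (path_sum \<delta> w) \<le> tree_const (real CARD('e)) q"
proof -
  define C0 where "C0 = potential_bound q"
  define C1 where "C1 = growth_cost (real CARD('e)) q"
  define m where "m j = running_max (\<lambda>v. a j (v @ w))" for j
  define s where "s u = (\<Sum>j\<in>J. m j u powr q)" for u
  define h where "h u = (\<Sum>j\<in>J. m j u powr (q - 1) * a j (u @ w))" for u
  define k where "k u = G (u @ w)" for u
  define p where "p = q / (q - 1)"
  define \<Psi> where "\<Psi> u = (2 * p * h u - s u) / k u powr q - C1 * (g (u @ w) / k u)" for u
  define D where "D e u = 2 * p * (\<Sum>j\<in>J. m j u powr (q - 1) * (a j (e # u @ w) - a j (u @ w))) / k u powr q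
      - C1 * ((g (e # u @ w) - g (u @ w)) / k u)" for e u
  have p: "1 \<le> p" using q by (simp add: p_def)
  have k: "0 < k u" for u by (simp add: k_def G_pos)
  have m_nonneg: "0 \<le> m j u" for j u
    unfolding m_def using running_max_ge[of "\<lambda>v. a j (v @ w)" u] a_nonneg[of j "u @ w"] by simp
  have m_Cons: "m j (e # u) = max (m j u) (a j (e # u @ w))" for j e u by (simp add: m_def)
  have C: "0 \<le> C0" "0 \<le> C1" using q by (auto simp: C0_def C1_def potential_bound_def growth_cost_def)
  have \<eta>: "(2 * p * h u - s u) / k u powr q \<le> C0" for u
  proof -
    have "2 * p * h u \<le> (\<Sum>j\<in>J. m j u powr q + C0 * a j (u @ w) powr q)"
      unfolding h_def sum_distrib_left C0_def potential_bound_def p_def[symmetric]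
      using p by (intro sum_mono powr_absorb q m_nonneg a_nonneg) auto
    also have "\<dots> \<le> s u + C0 * k u powr q"
      using mult_left_mono[OF sum_a_le_G[of "u @ w"] C(1)]
      by (simp add: sum.distrib s_def k_def sum_distrib_left)
    finally show ?thesis using k[of u] by (simp add: divide_le_eq)
  qed
  have \<Psi>_le: "\<Psi> u \<le> C0" for u
    using \<eta>[of u] mult_nonneg_nonneg[OF C(2), of "g (u @ w) / k u"] g_nonneg[of "u @ w"] k[of u]
    by (simp add: \<Psi>_def)
  have \<Psi>_root: "- C1 \<le> \<Psi> []"
  proof -
    have "h [] = s []"
      using q a_nonneg by (auto simp: h_def s_def m_def powr_mult_base mult.commute intro!: sum.cong)
    moreover have "0 \<le> s []" by (auto simp: s_def intro: sum_nonneg)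
    ultimately have "s [] \<le> 2 * p * h []" using p mult_right_mono[of 1 "2 * p" "s []"] by simp
    then have "0 \<le> (2 * p * h [] - s []) / k [] powr q" by simp
    moreover have "C1 * (g ([] @ w) / k []) \<le> C1 * 1"
      using C k[of "[]"] g_le_G[of w] by (intro mult_left_mono) (auto simp: k_def)
    ultimately show ?thesis by (simp add: \<Psi>_def)
  qed
  have step: "\<delta> (e # u @ w) \<le> \<Psi> (e # u) - \<Psi> u - D e u" for e u
  proof -
    let ?r = "k (e # u) / k u"
    let ?x = "\<lambda>j. a j (e # u @ w)" and ?y = "\<lambda>j. a j (u @ w)"
    have "S (e # u @ w) - S (u @ w) \<le> s (e # u) - s u"
      unfolding S_def s_def sum_subtractf[symmetric] running_max_append[of _ "u" w]
        running_max_append[of _ "e # u" w, simplified append_Cons] m_def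
      using q m_nonneg[unfolded m_def] by (intro sum_mono powr_max_diff_mono) auto
    then have d: "\<delta> (e # u @ w) \<le> (s (e # u) - s u) / k u powr q"
      by (simp add: k_def divide_right_mono)
    have "s (e # u) - s u \<le> (\<Sum>j\<in>J. p * ((m j (e # u) powr (q - 1) - m j u powr (q - 1)) * ?x j))"
      unfolding s_def sum_subtractf[symmetric] m_Cons p_def
      by (intro sum_mono powr_max_diff_le q m_nonneg a_nonneg)
    also have "\<dots> = p * (h (e # u) - h u - (\<Sum>j\<in>J. m j u powr (q - 1) * (?x j - ?y j)))"
      unfolding h_def by (simp add: sum_distrib_left sum_subtractf[symmetric] algebra_simps)
    \<comment> \<open>Twice the one-step Doob inequality, minus the increment of \<open>s\<close> itself: this puts \<open>- s\<close> into the
      potential, without which \<open>h / k powr q\<close> alone would not be bounded above.\<close>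
    finally have s: "s (e # u) - s u
      \<le> (2 * p * h (e # u) - s (e # u)) - (2 * p * h u - s u)
        - 2 * p * (\<Sum>j\<in>J. m j u powr (q - 1) * (?x j - ?y j))" (is "_ \<le> ?A - ?B - ?E")
      by (simp add: algebra_simps)
    have "(s (e # u) - s u) / k u powr q \<le> (?A - ?B - ?E) / k u powr q"
      by (intro divide_right_mono s) simp
    also have "\<dots> = ?A / k u powr q - ?B / k u powr q - ?E / k u powr q"
      by (simp add: diff_divide_distrib)
    finally have 1: "\<delta> (e # u @ w) \<le> ?A / k u powr q - ?B / k u powr q - ?E / k u powr q"
      using d by linarith
    have r: "1 \<le> ?r" "?r \<le> real CARD('e)"
      using k[of u] G_child_le[of e "u @ w"] G_Cons[of e "u @ w"] by (auto simp: k_def field_simps)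
    \<comment> \<open>Passing from the old to the new value of \<open>G\<close> in the denominator costs at most \<open>C1 * (?r - 1)\<close>.\<close>
    have "?A / k u powr q = ?A / k (e # u) powr q * ?r powr q"
      using k[of u] k[of "e # u"] by (simp add: powr_divide less_imp_le)
    also have "\<dots> = ?A / k (e # u) powr q + ?A / k (e # u) powr q * (?r powr q - 1)"
      by (simp only: right_diff_distrib mult_1_right)
    also have "?A / k (e # u) powr q * (?r powr q - 1)
        \<le> C0 * (q * real CARD('e) powr (q - 1) * (?r - 1))"
    proof (rule mult_mono[OF \<eta>])
      show "?r powr q - 1 \<le> q * real CARD('e) powr (q - 1) * (?r - 1)"
        by (rule powr_minus_one_le) (use q r in auto)
      show "0 \<le> ?r powr q - 1" using r q ge_one_powr_ge_zero[of ?r q] by simp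
    qed (use C in auto)
    also have "\<dots> = C1 * (?r - 1)" by (simp add: C0_def C1_def growth_cost_def)
    finally have 2: "?A / k u powr q \<le> ?A / k (e # u) powr q + C1 * (?r - 1)" by simp
    \<comment> \<open>If \<open>G\<close> grows, then its new value is the new value of \<open>g\<close>, and equality holds; so the growth of \<open>G\<close>
      is paid for by the decrease of \<open>g / G\<close>, up to a martingale difference.\<close>
    have "?r - 1 \<le> g (e # u @ w) / k u - g (e # u @ w) / k (e # u)"
      using k[of u] k[of "e # u"] g_le_G[of "e # u @ w"] G_Cons[of e "u @ w"]
      by (auto simp: k_def max_def field_simps split: if_splits)
    then have "C1 * (?r - 1) \<le> C1 * (g (e # u @ w) / k u - g (e # u @ w) / k (e # u))"
      using C(2) by (rule mult_left_mono)
    with 1 2 show ?thesis by (simp add: \<Psi>_def D_def algebra_simps diff_divide_distrib)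
  qed
  have D: "(\<Sum>e\<in>UNIV. D e u) = 0" for u
  proof -
    have "(\<Sum>e\<in>UNIV. \<Sum>j\<in>J. m j u powr (q - 1) * (a j (e # u @ w) - a j (u @ w)))
      = (\<Sum>j\<in>J. m j u powr (q - 1) * (\<Sum>e\<in>UNIV. a j (e # u @ w) - a j (u @ w)))"
      by (subst sum.swap) (simp add: sum_distrib_left)
    also have "\<dots> = 0" by (simp add: sum_subtractf a_average)
    finally have 1: "(\<Sum>e\<in>UNIV. \<Sum>j\<in>J. m j u powr (q - 1) * (a j (e # u @ w) - a j (u @ w))) = 0" .
    have 2: "(\<Sum>e\<in>UNIV. g (e # u @ w) - g (u @ w)) = 0" by (simp add: sum_subtractf g_average)
    have "(\<Sum>e\<in>UNIV. D e u) =
        2 * p * (\<Sum>e\<in>UNIV. \<Sum>j\<in>J. m j u powr (q - 1) * (a j (e # u @ w) - a j (u @ w))) / k u powr q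
        - C1 * ((\<Sum>e\<in>UNIV. g (e # u @ w) - g (u @ w)) / k u)"
      unfolding D_def by (subst sum_subtractf) (simp only: sum_distrib_left sum_divide_distrib)
    then show ?thesis unfolding 1 2 by simp
  qed
  have "word_mean N (path_sum \<delta> w) \<le> \<delta> w + word_mean N \<Psi> - \<Psi> []"
  proof (induction N)
    case 0 show ?case by simp
  next
    case (Suc N)
    have b: "real CARD('e) > 0" by simp
    have avg: "(\<Sum>e\<in>UNIV. path_sum \<delta> w (e # u)) / real CARD('e)
        \<le> path_sum \<delta> w u + ((\<Sum>e\<in>UNIV. \<Psi> (e # u)) / real CARD('e) + (-1) * \<Psi> u)" for u
    proof -
      have "(\<Sum>e\<in>UNIV. path_sum \<delta> w (e # u))
          \<le> (\<Sum>e\<in>UNIV. path_sum \<delta> w u + (\<Psi> (e # u) - \<Psi> u - D e u))"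
      proof (rule sum_mono)
        fix e show "path_sum \<delta> w (e # u) \<le> path_sum \<delta> w u + (\<Psi> (e # u) - \<Psi> u - D e u)"
          unfolding path_sum.simps using step[of e u] by linarith
      qed
      also have "\<dots> = (\<Sum>e\<in>UNIV. \<Psi> (e # u)) + real CARD('e) * (path_sum \<delta> w u - \<Psi> u)"
        using D by (simp add: sum.distrib sum_subtractf algebra_simps)
      finally show ?thesis using b by (simp add: field_simps)
    qed
    have "word_mean (Suc N) (path_sum \<delta> w)
        \<le> word_mean N (path_sum \<delta> w) + (word_mean (Suc N) \<Psi> + (-1) * word_mean N \<Psi>)"
      unfolding word_mean_Suc_Cons[of N] word_mean_cmult[symmetric] word_mean_add[symmetric]
      by (intro word_mean_mono avg)
    then show ?case using Suc by linarith
  qed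
  also have "word_mean N \<Psi> \<le> C0" using word_mean_mono[of \<Psi> "\<lambda>_. C0" N] \<Psi>_le by simp
  finally show ?thesis using \<delta>_le[of w] \<Psi>_root by (simp add: C0_def C1_def tree_const_def)
qed

lemma exponential_decay:
  "real (card {w. length w = N \<and> T * G w powr q < S w})
     \<le> 2 * exp (- (T / (2 * tree_const (real CARD('e)) q))) * real CARD('e) ^ N"
proof -
  define \<kappa> where "\<kappa> = tree_const (real CARD('e)) q"
  define \<beta> where "\<beta> = 1 / (2 * \<kappa>)"
  have \<beta>: "0 < \<beta>" "\<beta> * \<kappa> = 1 / 2" unfolding \<kappa>_def \<beta>_def using tree_const_pos[OF q, of "real CARD('e)"] by auto
  let ?B = "{w. length w = N \<and> T * G w powr q < S w}"
  have "exp (\<beta> * T) * real (card ?B) = (\<Sum>w\<in>?B. exp (\<beta> * T))" by simp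
  also have "\<dots> \<le> (\<Sum>w\<in>?B. exp (\<beta> * path_sum \<delta> [] w))"
  proof (intro sum_mono)
    fix w assume "w \<in> ?B"
    then have "T \<le> S w / G w powr q" using G_pos[of w] by (simp add: field_simps)
    then show "exp (\<beta> * T) \<le> exp (\<beta> * path_sum \<delta> [] w)"
      using S_le_path_sum[of w] \<beta> by simp
  qed
  also have "\<dots> \<le> (\<Sum>w | length w = N. exp (\<beta> * path_sum \<delta> [] w))"
    by (intro sum_mono2 finite_words) auto
  also have "\<dots> = word_mean N (\<lambda>w. exp (\<beta> * path_sum \<delta> [] w)) * real CARD('e) ^ N"
    by (simp add: word_mean_def)
  also have "\<dots> \<le> 2 * real CARD('e) ^ N"
  proof (rule mult_right_mono)
    have "word_mean N (\<lambda>w. exp (\<beta> * path_sum \<delta> [] w))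
        \<le> 1 + \<beta> / (1 - \<beta> * \<kappa>) * word_mean N (path_sum \<delta> [])"
      by (rule john_nirenberg_tree) (use \<delta>_nonneg local_mean_le \<beta> in \<open>auto simp: \<kappa>_def\<close>)
    also have "\<dots> \<le> 1 + \<beta> / (1 - \<beta> * \<kappa>) * \<kappa>"
      using \<beta> local_mean_le by (intro add_left_mono mult_left_mono) (auto simp: \<kappa>_def)
    also have "\<dots> = 2" using \<beta> by (simp add: field_simps)
    finally show "word_mean N (\<lambda>w. exp (\<beta> * path_sum \<delta> [] w)) \<le> 2" .
  qed simp
  finally show ?thesis by (simp add: \<beta>_def \<kappa>_def exp_minus field_simps)
qed

end

section \<open>Dyadic cells\<close>

lemma emeasure_cube:
  fixes c :: "real ^ 'n"
  assumes "0 \<le> h"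
  shows "emeasure lborel (cbox c (\<chi> i. c $ i + h)) = ennreal (h ^ CARD('n))"
    and "emeasure lborel (box c (\<chi> i. c $ i + h)) = ennreal (h ^ CARD('n))"
proof -
  have "(\<Prod>b\<in>Basis. ((\<chi> i. c $ i + h) - c) \<bullet> b) = (\<Prod>b\<in>(Basis :: (real ^ 'n) set). h)"
    by (rule prod.cong) (auto simp: Basis_vec_def inner_axis)
  then have p: "(\<Prod>b\<in>Basis. ((\<chi> i. c $ i + h) - c) \<bullet> b) = h ^ CARD('n)"
    by simp
  have le: "\<forall>b\<in>Basis. c \<bullet> b \<le> (\<chi> i. c $ i + h) \<bullet> b"
    using assms by (auto simp: Basis_vec_def inner_axis)
  show "emeasure lborel (cbox c (\<chi> i. c $ i + h)) = ennreal (h ^ CARD('n))"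
    unfolding emeasure_lborel_cbox_eq p using le by simp
  show "emeasure lborel (box c (\<chi> i. c $ i + h)) = ennreal (h ^ CARD('n))"
    unfolding emeasure_lborel_box_eq p using le by simp
qed

text \<open>A letter is the set of coordinates in which the child takes the upper half of its parent.\<close>
primrec corner :: "real ^ 'n \<Rightarrow> real \<Rightarrow> 'n set list \<Rightarrow> real ^ 'n" where
  "corner r L [] = r"
| "corner r L (e # w) = corner r L w + (\<chi> i. if i \<in> e then L / 2 ^ Suc (length w) else 0)"

text \<open>Half-open, so that the children of a cell partition it exactly.\<close>
definition cell :: "real ^ 'n \<Rightarrow> real \<Rightarrow> 'n set list \<Rightarrow> (real ^ 'n) set" where
  "cell r L w = {x. \<forall>i. corner r L w $ i \<le> x $ i \<and> x $ i < corner r L w $ i + L / 2 ^ length w}"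

lemma cell_Cons_iff:
  fixes r :: "real ^ 'n"
  assumes "0 < L"
  shows "y \<in> cell r L (e # w) \<longleftrightarrow>
    y \<in> cell r L w \<and> e = {i. corner r L w $ i + L / 2 ^ Suc (length w) \<le> y $ i}"
proof -
  define H where "H = L / 2 ^ Suc (length w)"
  have H: "0 < H" "L / 2 ^ length w = 2 * H" "L / (2 * 2 ^ length w) = H" using assms by (auto simp: H_def)
  have *: "y \<in> cell r L (e # w) \<longleftrightarrow>
    (\<forall>i. (corner r L w $ i \<le> y $ i \<and> y $ i < corner r L w $ i + 2 * H)
      \<and> (i \<in> e \<longleftrightarrow> corner r L w $ i + H \<le> y $ i))"
    unfolding cell_def mem_Collect_eq using H(1)
    by (intro all_cong1) (auto simp: H(3))
  show ?thesis unfolding * H_def[symmetric] by (auto simp: cell_def H(2))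
qed

lemma cell_antimono: "0 < L \<Longrightarrow> cell r L (u @ w) \<subseteq> cell r L w"
  by (induction u) (auto simp: cell_Cons_iff)

lemma cell_subset_cube: "cell r L w \<subseteq> cbox (corner r L w) (\<chi> i. corner r L w $ i + L / 2 ^ length w)"
  by (auto simp: cell_def mem_box_cart less_imp_le)

lemma cell_borel [measurable]: "cell r L w \<in> sets borel"
  unfolding cell_def by measurable

lemma cell_lebesgue: "cell r L w \<in> sets lebesgue"
  using cell_borel[of r L w] by simp

lemma emeasure_cell:
  fixes r :: "real ^ 'n"
  assumes "0 < L"
  shows "emeasure lebesgue (cell r L w) = ennreal ((L / 2 ^ length w) ^ CARD('n))"
proof -
  let ?c = "corner r L w" and ?h = "L / 2 ^ length w"
  have "box ?c (\<chi> i. ?c $ i + ?h) \<subseteq> cell r L w"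
    by (auto simp: cell_def mem_box_cart less_imp_le)
  then have "emeasure lborel (box ?c (\<chi> i. ?c $ i + ?h)) \<le> emeasure lborel (cell r L w)"
    by (intro emeasure_mono) auto
  moreover have "emeasure lborel (cell r L w) \<le> emeasure lborel (cbox ?c (\<chi> i. ?c $ i + ?h))"
    by (intro emeasure_mono cell_subset_cube) auto
  ultimately show ?thesis using assms by (simp add: emeasure_cube)
qed

text \<open>The branch of cells that shrink to a point \<open>x\<close> of the root cell.\<close>
primrec address :: "real ^ 'n \<Rightarrow> real \<Rightarrow> real ^ 'n \<Rightarrow> nat \<Rightarrow> 'n set list" where
  "address r L x 0 = []"
| "address r L x (Suc N) =
    {i. corner r L (address r L x N) $ i + L / 2 ^ Suc N \<le> x $ i} # address r L x N"

lemma length_address [simp]: "length (address r L x N) = N"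
  by (induction N) auto

lemma in_cell_address: "0 < L \<Longrightarrow> x \<in> cell r L [] \<Longrightarrow> x \<in> cell r L (address r L x N)"
  by (induction N) (auto simp: cell_Cons_iff)

lemma address_unique: "0 < L \<Longrightarrow> x \<in> cell r L w \<Longrightarrow> address r L x (length w) = w"
  by (induction w) (auto simp: cell_Cons_iff)

lemma set_nn_integral_cell_split:
  fixes r :: "real ^ 'n"
  assumes "0 < L" and [measurable]: "F \<in> borel_measurable lebesgue"
  shows "(\<integral>\<^sup>+y\<in>cell r L w. F y \<partial>lebesgue) = (\<Sum>e\<in>UNIV. \<integral>\<^sup>+y\<in>cell r L (e # w). F y \<partial>lebesgue)"
proof -
  have [measurable]: "cell r L v \<in> sets lebesgue" for v by (rule cell_lebesgue)
  have "(\<Sum>e\<in>UNIV. F y * indicator (cell r L (e # w)) y) = F y * indicator (cell r L w) y" for y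
  proof -
    have "(\<Sum>e\<in>UNIV. F y * indicator (cell r L (e # w)) y)
      = (\<Sum>e\<in>UNIV. if e = {i. corner r L w $ i + L / 2 ^ Suc (length w) \<le> y $ i}
          then F y * indicator (cell r L w) y else 0)"
      by (intro sum.cong) (auto simp: cell_Cons_iff[OF assms(1)] indicator_def)
    then show ?thesis by simp
  qed
  then show ?thesis by (subst nn_integral_sum[symmetric]) auto
qed

definition cell_average :: "real ^ 'n \<Rightarrow> real \<Rightarrow> (real ^ 'n \<Rightarrow> ennreal) \<Rightarrow> 'n set list \<Rightarrow> real" where
  "cell_average r L F w =
    enn2real (\<integral>\<^sup>+y\<in>cell r L w. F y \<partial>lebesgue) / (L / 2 ^ length w) ^ CARD('n)"

lemma set_nn_integral_cell:
  fixes r :: "real ^ 'n"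
  assumes "0 < L" "(\<integral>\<^sup>+y\<in>cell r L w. F y \<partial>lebesgue) < \<infinity>"
  shows "(\<integral>\<^sup>+y\<in>cell r L w. F y \<partial>lebesgue)
    = ennreal (cell_average r L F w * (L / 2 ^ length w) ^ CARD('n))"
  using assms by (simp add: cell_average_def ennreal_enn2real)

lemma cell_average_split:
  fixes r :: "real ^ 'n"
  assumes L: "0 < L" and F: "F \<in> borel_measurable lebesgue" and fin: "(\<integral>\<^sup>+y. F y \<partial>lebesgue) < \<infinity>"
  shows "(\<Sum>e\<in>UNIV. cell_average r L F (e # w)) = real CARD('n set) * cell_average r L F w"
proof -
  have "(\<integral>\<^sup>+y\<in>cell r L v. F y \<partial>lebesgue) < \<infinity>" for v
    by (rule le_less_trans[OF nn_integral_mono fin]) (auto simp: indicator_def)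
  then have "enn2real (\<integral>\<^sup>+y\<in>cell r L w. F y \<partial>lebesgue)
    = (\<Sum>e\<in>UNIV. enn2real (\<integral>\<^sup>+y\<in>cell r L (e # w). F y \<partial>lebesgue))"
    using L F by (simp add: set_nn_integral_cell_split[of L F r w] enn2real_sum)
  moreover have "(L / 2 ^ length w) ^ CARD('n) = 2 ^ CARD('n) * (L / 2 ^ Suc (length w)) ^ CARD('n)"
    by (simp add: power_mult_distrib power_divide)
  ultimately show ?thesis
    using L by (simp add: cell_average_def sum_divide_distrib[symmetric] card_UNIV_set power_mult_distrib)
qed

section \<open>The maximal operator\<close>

lemma ennreal_less_divide_iff:
  assumes "0 < v" "0 \<le> t"
  shows "ennreal t < I / ennreal v \<longleftrightarrow> ennreal (t * v) < I"
proof (cases I)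
  case (real c)
  then show ?thesis using assms by (simp add: divide_ennreal pos_less_divide_eq ennreal_less_iff)
next
  case top
  then show ?thesis using assms by (simp add: ennreal_top_divide)
qed

lemma hl_maximal_ge:
  fixes c :: "real ^ 'n"
  assumes "0 < h" "x \<in> cbox c (\<chi> i. c $ i + h)"
  shows "(\<integral>\<^sup>+y\<in>cbox c (\<chi> i. c $ i + h). F y \<partial>lebesgue) / ennreal (h ^ CARD('n)) \<le> hl_maximal F x"
proof -
  have "emeasure lebesgue (cbox c (\<chi> i. c $ i + h)) = ennreal (h ^ CARD('n))"
    using assms by (simp add: emeasure_cube)
  then show ?thesis unfolding hl_maximal_def
    using assms by (intro SUP_upper2[of "cbox c (\<chi> i. c $ i + h)"]) (auto simp: is_cube_def)
qed

text \<open>A cube with average above \<open>t\<close> can be enlarged a little so that it contains \<open>x\<close> in its interior and its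
average stays above \<open>t\<close>, because the integral does not decrease and the volume depends continuously on
the side. The interior then lies in the superlevel set. This is what makes all level sets measurable.\<close>
lemma open_hl_maximal_superlevel:
  fixes F :: "real ^ 'n \<Rightarrow> ennreal"
  shows "open {x. t < hl_maximal F x}"
proof (subst open_subopen, safe)
  fix x assume "t < hl_maximal F x"
  then obtain a l where l: "0 < l" and x: "x \<in> cbox a (\<chi> i. a $ i + l)"
    and "t < (\<integral>\<^sup>+y\<in>cbox a (\<chi> i. a $ i + l). F y \<partial>lebesgue) / emeasure lebesgue (cbox a (\<chi> i. a $ i + l))"
    unfolding hl_maximal_def less_SUP_iff is_cube_def by auto
  then have t: "t < (\<integral>\<^sup>+y\<in>cbox a (\<chi> i. a $ i + l). F y \<partial>lebesgue) / ennreal (l ^ CARD('n))"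
    by (simp add: emeasure_cube)
  then obtain s where s: "t = ennreal s" "0 \<le> s" by (cases t) (auto simp: top_unique)
  define I where "I = (\<integral>\<^sup>+y\<in>cbox a (\<chi> i. a $ i + l). F y \<partial>lebesgue)"
  have "ennreal (s * l ^ CARD('n)) < I"
    using t l s by (simp add: ennreal_less_divide_iff I_def)
  moreover have "((\<lambda>\<epsilon>. ennreal (s * (l + 2 * \<epsilon>) ^ CARD('n))) \<longlongrightarrow> ennreal (s * (l + 2 * 0) ^ CARD('n)))
      (at_right 0)"
    by (intro tendsto_intros)
  ultimately have "\<forall>\<^sub>F \<epsilon> in at_right 0. ennreal (s * (l + 2 * \<epsilon>) ^ CARD('n)) < I"
    by (intro order_tendstoD(2)) auto
  then have "\<forall>\<^sub>F \<epsilon> in at_right 0. ennreal (s * (l + 2 * \<epsilon>) ^ CARD('n)) < I \<and> 0 < \<epsilon>"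
    using eventually_at_right_less[of "0::real"] by eventually_elim auto
  then obtain \<epsilon> where \<epsilon>: "0 < \<epsilon>" "ennreal (s * (l + 2 * \<epsilon>) ^ CARD('n)) < I"
    using eventually_happens'[OF trivial_limit_at_right_real] by blast
  define b where "b = (\<chi> i. a $ i - \<epsilon>)"
  let ?R = "cbox b (\<chi> i. b $ i + (l + 2 * \<epsilon>))" and ?R' = "box b (\<chi> i. b $ i + (l + 2 * \<epsilon>))"
  have sub: "cbox a (\<chi> i. a $ i + l) \<subseteq> ?R'"
  proof
    fix y assume "y \<in> cbox a (\<chi> i. a $ i + l)"
    then have "a $ i \<le> y $ i" "y $ i \<le> a $ i + l" for i by (auto simp: mem_box_cart)
    then have "a $ i - \<epsilon> < y $ i" "y $ i < a $ i - \<epsilon> + (l + 2 * \<epsilon>)" for i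
      using \<epsilon>(1) by (smt (verit))+
    then show "y \<in> ?R'" by (simp add: mem_box_cart b_def)
  qed
  then have "I \<le> (\<integral>\<^sup>+y\<in>?R. F y \<partial>lebesgue)"
    unfolding I_def using box_subset_cbox[of b]
    by (intro nn_integral_mono) (auto simp: indicator_def)
  then have "t < (\<integral>\<^sup>+y\<in>?R. F y \<partial>lebesgue) / ennreal ((l + 2 * \<epsilon>) ^ CARD('n))"
    unfolding s(1) using \<epsilon> l s by (subst ennreal_less_divide_iff) (auto intro: less_le_trans)
  moreover have "\<dots> \<le> hl_maximal F y" if "y \<in> ?R'" for y
    using box_subset_cbox[of b] that \<epsilon>(1) l by (intro hl_maximal_ge) auto
  ultimately have "t < hl_maximal F y" if "y \<in> ?R'" for y
    using that by (meson less_le_trans)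
  then show "\<exists>T. open T \<and> x \<in> T \<and> T \<subseteq> {x. t < hl_maximal F x}"
    using sub x by (intro exI[of _ ?R']) auto
qed

lemma hl_maximal_measurable: "hl_maximal F \<in> borel_measurable lebesgue"
proof -
  have "hl_maximal F \<in> borel_measurable borel"
    by (rule borel_measurableI_greater) (auto intro: borel_open open_hl_maximal_superlevel)
  then show ?thesis by (intro measurable_completion) simp
qed

lemma cell_average_le_hl_maximal:
  fixes r :: "real ^ 'n"
  assumes L: "0 < L" and x: "x \<in> cell r L w" and fin: "(\<integral>\<^sup>+y. F y \<partial>lebesgue) < \<infinity>"
  shows "ennreal (cell_average r L F w) \<le> hl_maximal F x"
proof -
  let ?h = "L / 2 ^ length w" and ?c = "corner r L w"
  have h: "0 < ?h" using L by simp
  have f: "(\<integral>\<^sup>+y\<in>cell r L w. F y \<partial>lebesgue) < \<infinity>"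
    by (rule le_less_trans[OF nn_integral_mono fin]) (auto simp: indicator_def)
  have "ennreal (cell_average r L F w) = (\<integral>\<^sup>+y\<in>cell r L w. F y \<partial>lebesgue) / ennreal (?h ^ CARD('n))"
    using h f by (subst set_nn_integral_cell) (auto simp: L divide_ennreal cell_average_def simp del: power_divide)
  also have "\<dots> \<le> (\<integral>\<^sup>+y\<in>cbox ?c (\<chi> i. ?c $ i + ?h). F y \<partial>lebesgue) / ennreal (?h ^ CARD('n))"
    using cell_subset_cube[of r L w]
    by (intro divide_right_mono_ennreal nn_integral_mono) (auto simp: indicator_def)
  also have "\<dots> \<le> hl_maximal F x"
    using h x cell_subset_cube[of r L w] by (intro hl_maximal_ge) auto
  finally show ?thesis .
qed

section \<open>Real powers and Minkowski's integral inequality\<close>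

lemma ennreal_powr_ennreal: "0 \<le> x \<Longrightarrow> ennreal_powr (ennreal x) p = ennreal (x powr p)"
  by (simp add: ennreal_powr_def)

lemma ennreal_powr_mono: "0 \<le> p \<Longrightarrow> u \<le> v \<Longrightarrow> ennreal_powr u p \<le> ennreal_powr v p"
  by (cases u; cases v) (auto simp: ennreal_powr_def powr_mono2 top_unique)

lemma ennreal_powr_inverse: "0 < p \<Longrightarrow> ennreal_powr (ennreal_powr u p) (1 / p) = u"
  by (cases u) (auto simp: ennreal_powr_def powr_powr)

lemma ennreal_powr_inverse': "0 < p \<Longrightarrow> ennreal_powr (ennreal_powr u (1 / p)) p = u"
  using ennreal_powr_inverse[of "1 / p" u] by simp

lemma ennreal_powr_le_iff:
  assumes "0 < p"
  shows "ennreal_powr u p \<le> v \<longleftrightarrow> u \<le> ennreal_powr v (1 / p)"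
proof
  assume "ennreal_powr u p \<le> v"
  then have "ennreal_powr (ennreal_powr u p) (1 / p) \<le> ennreal_powr v (1 / p)"
    using assms by (intro ennreal_powr_mono) auto
  then show "u \<le> ennreal_powr v (1 / p)" using assms by (simp add: ennreal_powr_inverse)
next
  assume "u \<le> ennreal_powr v (1 / p)"
  then have "ennreal_powr u p \<le> ennreal_powr (ennreal_powr v (1 / p)) p"
    using assms by (intro ennreal_powr_mono) auto
  then show "ennreal_powr u p \<le> v" using assms by (simp add: ennreal_powr_inverse')
qed

lemma ennreal_powr_cmult:
  assumes "0 < t"
  shows "ennreal_powr (ennreal t * u) p = ennreal (t powr p) * ennreal_powr u p"
proof (cases u)
  case (real x)
  then show ?thesis using assms by (simp add: ennreal_powr_ennreal ennreal_mult[symmetric] powr_mult)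
next
  case top
  then show ?thesis using assms by (simp add: ennreal_powr_def ennreal_mult_top)
qed

lemma measurable_ennreal_powr [measurable]:
  assumes [measurable]: "f \<in> borel_measurable M"
  shows "(\<lambda>x. ennreal_powr (f x) p) \<in> borel_measurable M"
  unfolding ennreal_powr_def by measurable

lemma measurable_lq_norm [measurable]:
  assumes [measurable]: "\<And>j. (\<lambda>x. u x j) \<in> borel_measurable M"
  shows "(\<lambda>x. lq_norm q (u x)) \<in> borel_measurable M"
  unfolding lq_norm_def by measurable

lemma holder_powr:
  fixes m x :: "'j \<Rightarrow> real"
  assumes q: "1 < q" and fin: "finite J" and nonneg: "\<And>j. 0 \<le> m j" "\<And>j. 0 \<le> x j" "0 \<le> H" "0 \<le> \<gamma>"
    and m: "(\<Sum>j\<in>J. m j powr q) \<le> H powr q" and x: "(\<Sum>j\<in>J. x j powr q) \<le> \<gamma> powr q"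
  shows "(\<Sum>j\<in>J. m j powr (q - 1) * x j) \<le> H powr (q - 1) * \<gamma>"
proof (cases "H = 0 \<or> \<gamma> = 0")
  case True
  have zero: "y j = 0" if "(\<Sum>j\<in>J. y j powr q) \<le> 0 powr q" "j \<in> J" "\<And>j. 0 \<le> y j" for y j
  proof -
    have "y j powr q \<le> (\<Sum>j\<in>J. y j powr q)" using that fin by (intro member_le_sum) auto
    moreover have "0 \<le> y j powr q" by simp
    moreover have "(\<Sum>j\<in>J. y j powr q) \<le> 0" using that(1) by simp
    ultimately have "y j powr q = 0" by linarith
    then show ?thesis by simp
  qed
  have "m j powr (q - 1) * x j = 0" if "j \<in> J" for j
    using True
  proof
    assume "H = 0" then show ?thesis using zero[of m j] m that nonneg q by auto
  next
    assume "\<gamma> = 0" then show ?thesis using zero[of x j] x that nonneg q by auto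
  qed
  then have "(\<Sum>j\<in>J. m j powr (q - 1) * x j) = 0" by (intro sum.neutral) blast
  then show ?thesis using nonneg by simp
next
  case False
  then have pos: "0 < H" "0 < \<gamma>" using nonneg by auto
  have "q * (\<Sum>j\<in>J. (m j / H) powr (q - 1) * (x j / \<gamma>))
    \<le> (\<Sum>j\<in>J. (q - 1) * (m j / H) powr q + (x j / \<gamma>) powr q)"
    unfolding sum_distrib_left by (intro sum_mono young_powr q) (use pos nonneg in auto)
  also have "\<dots> = (q - 1) * ((\<Sum>j\<in>J. m j powr q) / H powr q) + (\<Sum>j\<in>J. x j powr q) / \<gamma> powr q"
    using pos nonneg by (simp add: sum.distrib sum_distrib_left sum_divide_distrib powr_divide)
  also have "\<dots> \<le> (q - 1) * 1 + 1"
    using m x q pos by (intro add_mono mult_left_mono) auto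
  finally have "(\<Sum>j\<in>J. (m j / H) powr (q - 1) * (x j / \<gamma>)) \<le> 1" using q by simp
  also have "(\<Sum>j\<in>J. (m j / H) powr (q - 1) * (x j / \<gamma>))
    = (\<Sum>j\<in>J. m j powr (q - 1) * x j) / (H powr (q - 1) * \<gamma>)"
    using pos nonneg by (simp add: powr_divide sum_divide_distrib)
  finally show ?thesis using pos by (simp add: divide_le_eq)
qed

text \<open>With \<open>I\<^sub>j\<close> the integral of \<open>\<phi>\<^sub>j\<close>, integrate Hoelder's inequality for the sequences \<open>I\<^sub>j powr (q - 1)\<close> and
\<open>\<phi>\<^sub>j y\<close>: the left-hand side becomes \<open>\<Sum>\<^sub>j I\<^sub>j powr q = H powr q\<close> and the right-hand side
\<open>H powr (q - 1)\<close> times the integral of \<open>g\<close>. The function \<open>g\<close> has extended values because it stands for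
\<open>|f|\<^sub>q\<close>, which may be infinite on a null set.\<close>
lemma minkowski_integral:
  fixes \<phi> :: "'j \<Rightarrow> 'a \<Rightarrow> real"
  assumes q: "1 < q" and fin: "finite J"
    and meas [measurable]: "\<And>j. \<phi> j \<in> borel_measurable M" "g \<in> borel_measurable M"
    and nonneg: "\<And>j y. 0 \<le> \<phi> j y"
    and le: "\<And>y. (\<Sum>j\<in>J. ennreal (\<phi> j y powr q)) \<le> ennreal_powr (g y) q"
    and g: "(\<integral>\<^sup>+y. g y \<partial>M) < \<infinity>"
  shows "(\<Sum>j\<in>J. enn2real (\<integral>\<^sup>+y. ennreal (\<phi> j y) \<partial>M) powr q) \<le> enn2real (\<integral>\<^sup>+y. g y \<partial>M) powr q"
proof -
  define I where "I j = enn2real (\<integral>\<^sup>+y. ennreal (\<phi> j y) \<partial>M)" for j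
  define H where "H = (\<Sum>j\<in>J. I j powr q) powr (1 / q)"
  have Hq: "H powr q = (\<Sum>j\<in>J. I j powr q)"
    using q by (simp add: H_def powr_powr sum_nonneg)
  show ?thesis
  proof (cases "H = 0")
    case True then show ?thesis using Hq q by (simp add: I_def)
  next
    case False
    then have H: "0 < H" by (simp add: H_def less_le)
    have pt: "\<phi> j y \<le> c" if "j \<in> J" "g y = ennreal c" "0 \<le> c" for j y c
    proof -
      have "ennreal (\<phi> j y powr q) \<le> (\<Sum>j\<in>J. ennreal (\<phi> j y powr q))"
        using fin that by (intro member_le_sum) auto
      also have "\<dots> \<le> ennreal (c powr q)" using le[of y] that by (simp add: ennreal_powr_ennreal)
      finally have "\<phi> j y powr q \<le> c powr q" by simp
      then show ?thesis using powr_less_mono2[of q c "\<phi> j y"] q that by force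
    qed
    have int_le: "(\<integral>\<^sup>+y. ennreal (\<phi> j y) \<partial>M) \<le> (\<integral>\<^sup>+y. g y \<partial>M)" if "j \<in> J" for j
    proof (rule nn_integral_mono)
      fix y show "ennreal (\<phi> j y) \<le> g y"
        by (cases "g y") (use pt[OF that, of y] in auto)
    qed
    have I: "(\<integral>\<^sup>+y. ennreal (\<phi> j y) \<partial>M) = ennreal (I j)" if "j \<in> J" for j
      using le_less_trans[OF int_le[OF that] g] by (simp add: I_def)
    have "ennreal (\<Sum>j\<in>J. I j powr (q - 1) * \<phi> j y) \<le> ennreal (H powr (q - 1)) * g y" for y
    proof (cases "g y")
      case (real c)
      have "(\<Sum>j\<in>J. \<phi> j y powr q) \<le> c powr q"
        using le[of y] real by (simp add: ennreal_powr_ennreal)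
      then have "(\<Sum>j\<in>J. I j powr (q - 1) * \<phi> j y) \<le> H powr (q - 1) * c"
        using real H nonneg q fin by (intro holder_powr) (auto simp: Hq I_def)
      then show ?thesis using real by (simp add: ennreal_mult[symmetric])
    next
      case top then show ?thesis using H by (simp add: ennreal_mult_top)
    qed
    then have "(\<integral>\<^sup>+y. ennreal (\<Sum>j\<in>J. I j powr (q - 1) * \<phi> j y) \<partial>M)
        \<le> ennreal (H powr (q - 1)) * (\<integral>\<^sup>+y. g y \<partial>M)"
      by (subst nn_integral_cmult[symmetric]) (auto intro: nn_integral_mono)
    also have "(\<integral>\<^sup>+y. ennreal (\<Sum>j\<in>J. I j powr (q - 1) * \<phi> j y) \<partial>M)
        = (\<Sum>j\<in>J. ennreal (I j powr (q - 1)) * ennreal (I j))"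
      using nonneg by (simp add: sum_ennreal[symmetric] ennreal_mult nn_integral_sum nn_integral_cmult I
          cong: sum.cong del: sum_ennreal)
    also have "\<dots> = ennreal (\<Sum>j\<in>J. I j powr (q - 1) * I j)"
      by (simp add: ennreal_mult[symmetric] I_def)
    also have "(\<Sum>j\<in>J. I j powr (q - 1) * I j) = H powr (q - 1) * H"
      using Hq H by (simp add: powr_mult_base I_def mult.commute)
    also have "(\<integral>\<^sup>+y. g y \<partial>M) = ennreal (enn2real (\<integral>\<^sup>+y. g y \<partial>M))" using g by simp
    finally have "H powr (q - 1) * H \<le> H powr (q - 1) * enn2real (\<integral>\<^sup>+y. g y \<partial>M)"
      using H by (simp add: ennreal_mult[symmetric])
    then have "H \<le> enn2real (\<integral>\<^sup>+y. g y \<partial>M)" using H by simp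
    then show ?thesis using H q powr_mono2[of q H] by (simp add: Hq I_def)
  qed
qed

section \<open>Covering cubes by cells of shifted trees\<close>

lemma corner_on_grid: "\<exists>m :: int. corner r L w $ i = r $ i + of_int m * (L / 2 ^ length w)"
proof (induction w)
  case Nil show ?case by (auto intro: exI[of _ 0])
next
  case (Cons e w)
  then obtain m :: int where m: "corner r L w $ i = r $ i + of_int m * (L / 2 ^ length w)" by auto
  show ?case
    by (rule exI[of _ "2 * m + (if i \<in> e then 1 else 0)"]) (simp add: m field_simps)
qed

text \<open>A shift is given by the set of the coordinates in which the root is translated by \<open>- l\<close>, one third of
its side \<open>3 l\<close>. All these roots contain the cube with corner \<open>a\<close> and side \<open>l\<close>.\<close>
definition shifted_root :: "real ^ 'n \<Rightarrow> real \<Rightarrow> 'n set \<Rightarrow> real ^ 'n" where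
  "shifted_root a l s = (\<chi> i. a $ i - (if i \<in> s then l else 0))"

lemma cube_subset_shifted_root_cell:
  assumes "0 < l"
  shows "cbox a (\<chi> i. a $ i + l) \<subseteq> cell (shifted_root a l s) (3 * l) []"
proof
  fix y assume "y \<in> cbox a (\<chi> i. a $ i + l)"
  then have "a $ i \<le> y $ i" "y $ i \<le> a $ i + l" for i by (auto simp: mem_box_cart)
  then have "shifted_root a l s $ i \<le> y $ i \<and> y $ i < shifted_root a l s $ i + 3 * l" for i
    using assms by (simp add: shifted_root_def) (smt (verit))
  then show "y \<in> cell (shifted_root a l s) (3 * l) []" by (simp add: cell_def)
qed

lemma dyadic_scale:
  fixes l \<mu> :: real
  assumes "0 < \<mu>" "\<mu> \<le> l"
  obtains k where "\<mu> \<le> l / 2 ^ k" "l / 2 ^ k \<le> 2 * \<mu>"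
proof -
  have "\<exists>k. l / 2 ^ k \<le> 2 * \<mu>"
  proof -
    obtain k where "l / \<mu> < 2 ^ k" using real_arch_pow[of 2 "l / \<mu>"] by auto
    then have "l / 2 ^ k \<le> 2 * \<mu>" using assms by (simp add: field_simps)
    then show ?thesis ..
  qed
  define k where "k = (LEAST k. l / 2 ^ k \<le> 2 * \<mu>)"
  have k: "l / 2 ^ k \<le> 2 * \<mu>" unfolding k_def by (rule LeastI_ex) fact
  have "\<mu> \<le> l / 2 ^ k"
  proof (cases k)
    case 0 then show ?thesis using assms by simp
  next
    case (Suc j)
    then have "\<not> l / 2 ^ j \<le> 2 * \<mu>" using not_less_Least[of j "\<lambda>k. l / 2 ^ k \<le> 2 * \<mu>"] by (simp add: k_def)
    then show ?thesis using Suc by (simp add: field_simps)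
  qed
  with k that show thesis by blast
qed

lemma three_not_dvd_power_2: "\<not> (3 :: int) dvd 2 ^ k"
proof
  assume "(3 :: int) dvd 2 ^ k"
  moreover have "prime (3 :: int)" by (simp add: prime_int_numeral_eq)
  ultimately have "(3 :: int) dvd 2" using prime_dvd_power by blast
  then show False by presburger
qed

text \<open>In units of \<open>l / 2 ^ k\<close> the difference is the integer \<open>3 (m - m') + 2 ^ k\<close>, which is not zero because
\<open>3\<close> does not divide a power of \<open>2\<close>.\<close>
lemma grids_one_third_apart:
  fixes m m' :: int and a l :: real
  assumes "0 < l"
  shows "l / 2 ^ k \<le> \<bar>(a + of_int m * (3 * l / 2 ^ k)) - (a - l + of_int m' * (3 * l / 2 ^ k))\<bar>"
proof -
  have "2 ^ k \<noteq> 3 * (m' - m)" using three_not_dvd_power_2[of k] by (metis dvd_triv_left)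
  then have "3 * (m - m') + 2 ^ k \<noteq> 0" by (simp add: algebra_simps)
  moreover have "z \<noteq> 0 \<Longrightarrow> 1 \<le> \<bar>z\<bar>" for z :: int by linarith
  ultimately have "1 \<le> \<bar>3 * (m - m') + 2 ^ k\<bar>" by blast
  then have "(1 :: real) \<le> of_int \<bar>3 * (m - m') + 2 ^ k\<bar>" by linarith
  then have "l / 2 ^ k * 1 \<le> l / 2 ^ k * \<bar>3 * (of_int m - of_int m') + 2 ^ k\<bar>"
    using assms by (intro mult_left_mono) auto
  also have "\<dots> = \<bar>l / 2 ^ k * (3 * (of_int m - of_int m') + 2 ^ k)\<bar>"
    using assms by (simp add: abs_mult)
  also have "l / 2 ^ k * (3 * (of_int m - of_int m') + 2 ^ k)
      = (a + of_int m * (3 * l / 2 ^ k)) - (a - l + of_int m' * (3 * l / 2 ^ k))"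
    by (simp add: field_simps)
  finally show ?thesis by simp
qed

text \<open>The intersection of the two cubes is a box with sides of length at most \<open>l / 2 ^ k\<close>, a third of the mesh
\<open>\<eta>\<close> at level \<open>k\<close>. In each coordinate, the grid points of the unshifted and of the shifted tree are at
least that far apart, so one of the two grids does not cut the side. Choosing the shift coordinate by
coordinate, the cell at level \<open>k\<close> around \<open>x\<close> contains the box.\<close>
lemma cube_in_shifted_cell:
  fixes a c :: "real ^ 'n"
  assumes l: "0 < l" and h: "0 < h"
    and x: "x \<in> cbox a (\<chi> i. a $ i + l)" "x \<in> cbox c (\<chi> i. c $ i + h)"
  obtains s w where "x \<in> cell (shifted_root a l s) (3 * l) w"
    and "cbox a (\<chi> i. a $ i + l) \<inter> cbox c (\<chi> i. c $ i + h) \<subseteq> cell (shifted_root a l s) (3 * l) w"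
    and "3 * l / 2 ^ length w \<le> 6 * h"
proof -
  obtain k where k: "min h l \<le> l / 2 ^ k" "l / 2 ^ k \<le> 2 * min h l"
    using dyadic_scale[of "min h l" l] l h by auto
  define \<eta> where "\<eta> = 3 * l / 2 ^ k"
  define u where "u i = max (a $ i) (c $ i)" for i
  define v where "v i = min (a $ i + l) (c $ i + h)" for i
  have uv: "v i - u i \<le> l / 2 ^ k" for i
  proof -
    have "v i - u i \<le> h" "v i - u i \<le> l" by (auto simp: u_def v_def min_def max_def)
    then show ?thesis using k(1) by linarith
  qed
  define s where "s = {i. \<exists>m :: int. u i < a $ i + of_int m * \<eta> \<and> a $ i + of_int m * \<eta> \<le> v i}"
  define r where "r = shifted_root a l s"
  \<comment> \<open>The intervals \<open>u i < z \<le> v i\<close> are open on the left because a half-open cell may begin at \<open>u i\<close>, but must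
    not end at \<open>v i\<close>.\<close>
  have no_grid_point: "\<not> (u i < r $ i + of_int m * \<eta> \<and> r $ i + of_int m * \<eta> \<le> v i)" for i and m :: int
  proof (cases "i \<in> s")
    case True
    then obtain m' :: int where m': "u i < a $ i + of_int m' * \<eta>" "a $ i + of_int m' * \<eta> \<le> v i"
      by (auto simp: s_def)
    have "r $ i = a $ i - l" using True by (simp add: r_def shifted_root_def)
    then show ?thesis
      using grids_one_third_apart[OF l, of k "a $ i" m' m] m' uv[of i] unfolding \<eta>_def by (auto simp: abs_if split: if_splits)
  next
    case False
    then show ?thesis by (auto simp: s_def r_def shifted_root_def)
  qed
  define w where "w = address r (3 * l) x k"
  have len: "length w = k" by (simp add: w_def)
  have xw: "x \<in> cell r (3 * l) w"
    using in_cell_address[of "3 * l" x r k] cube_subset_shifted_root_cell[OF l, of a s] l x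
    by (auto simp: w_def r_def)
  have xuv: "u i \<le> x $ i" "x $ i \<le> v i" for i
    using x by (auto simp: u_def v_def mem_box_cart)
  have xc: "corner r (3 * l) w $ i \<le> x $ i" "x $ i < corner r (3 * l) w $ i + \<eta>" for i
    using xw by (auto simp: cell_def len \<eta>_def)
  have *: "corner r (3 * l) w $ i \<le> u i" "v i < corner r (3 * l) w $ i + \<eta>" for i
  proof -
    obtain m :: int where m: "corner r (3 * l) w $ i = r $ i + of_int m * \<eta>"
      using corner_on_grid[of r "3 * l" w i] by (auto simp: len \<eta>_def)
    then show "corner r (3 * l) w $ i \<le> u i"
      using no_grid_point[of i m] xc[of i] xuv[of i] by auto
    have "corner r (3 * l) w $ i + \<eta> = r $ i + of_int (m + 1) * \<eta>"
      using m by (simp add: algebra_simps)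
    then show "v i < corner r (3 * l) w $ i + \<eta>"
      using no_grid_point[of i "m + 1"] xc[of i] xuv[of i] by auto
  qed
  have "cbox a (\<chi> i. a $ i + l) \<inter> cbox c (\<chi> i. c $ i + h) \<subseteq> cell r (3 * l) w"
  proof
    fix y assume "y \<in> cbox a (\<chi> i. a $ i + l) \<inter> cbox c (\<chi> i. c $ i + h)"
    then have "u i \<le> y $ i" "y $ i \<le> v i" for i by (auto simp: u_def v_def mem_box_cart)
    then have "corner r (3 * l) w $ i \<le> y $ i \<and> y $ i < corner r (3 * l) w $ i + \<eta>" for i
      using *[of i] by (meson le_less_trans order_trans)
    then show "y \<in> cell r (3 * l) w" by (simp add: cell_def len \<eta>_def)
  qed
  moreover have "3 * l / 2 ^ length w \<le> 6 * h" using k(2) by (simp add: len)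
  ultimately show thesis using that xw unfolding r_def by blast
qed

lemma hl_maximal_le_shifted_cells:
  fixes a :: "real ^ 'n"
  assumes l: "0 < l" and x: "x \<in> cbox a (\<chi> i. a $ i + l)"
    and supp: "\<And>y. y \<notin> cbox a (\<chi> i. a $ i + l) \<Longrightarrow> F y = 0"
    and fin: "(\<integral>\<^sup>+y. F y \<partial>lebesgue) < \<infinity>"
    and le: "\<And>s w. x \<in> cell (shifted_root a l s) (3 * l) w \<Longrightarrow>
      ennreal (6 ^ CARD('n) * cell_average (shifted_root a l s) (3 * l) F w) \<le> C"
  shows "hl_maximal F x \<le> C"
  unfolding hl_maximal_def
proof (rule SUP_least, clarsimp simp: is_cube_def)
  fix c :: "real ^ 'n" and h :: real
  assume h: "0 < h" and xc: "x \<in> cbox c (\<chi> i. c $ i + h)"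
  obtain s w where xw: "x \<in> cell (shifted_root a l s) (3 * l) w"
    and sub: "cbox a (\<chi> i. a $ i + l) \<inter> cbox c (\<chi> i. c $ i + h) \<subseteq> cell (shifted_root a l s) (3 * l) w"
    and size: "3 * l / 2 ^ length w \<le> 6 * h"
    using cube_in_shifted_cell[OF l h x xc] .
  let ?A = "cell_average (shifted_root a l s) (3 * l) F w" and ?\<eta> = "3 * l / 2 ^ length w"
  have A: "0 \<le> ?A" using l by (simp add: cell_average_def)
  have "(\<integral>\<^sup>+y\<in>cbox c (\<chi> i. c $ i + h). F y \<partial>lebesgue)
      \<le> (\<integral>\<^sup>+y\<in>cell (shifted_root a l s) (3 * l) w. F y \<partial>lebesgue)"
    using sub supp by (intro nn_integral_mono) (fastforce simp: indicator_def)
  also have "\<dots> = ennreal (?A * ?\<eta> ^ CARD('n))"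
    using l by (intro set_nn_integral_cell le_less_trans[OF nn_integral_mono fin]) (auto simp: indicator_def)
  also have "\<dots> \<le> ennreal (?A * (6 * h) ^ CARD('n))"
    using A l size by (intro ennreal_leI mult_left_mono power_mono) auto
  also have "\<dots> = ennreal (6 ^ CARD('n) * ?A) * ennreal (h ^ CARD('n))"
    using A h by (simp add: ennreal_mult[symmetric] power_mult_distrib mult_ac)
  finally have "(\<integral>\<^sup>+y\<in>cbox c (\<chi> i. c $ i + h). F y \<partial>lebesgue) / ennreal (h ^ CARD('n))
      \<le> ennreal (6 ^ CARD('n) * ?A)"
    using h by (intro divide_le_posI_ennreal) (auto simp: mult.commute)
  also have "\<dots> \<le> C" by (rule le[OF xw])
  finally show "(\<integral>\<^sup>+y\<in>cbox c (\<chi> i. c $ i + h). F y \<partial>lebesgue)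
      / emeasure lborel (cbox c (\<chi> i. c $ i + h)) \<le> C"
    using h by (simp add: emeasure_cube)
qed

section \<open>Level sets for finitely many functions and finite depth\<close>

lemma cell_average_minkowski:
  fixes r :: "real ^ 'n"
  assumes q: "1 < q" and fin: "finite J" and L: "0 < L"
    and meas [measurable]: "\<And>j. f j \<in> borel_measurable lebesgue" "g \<in> borel_measurable lebesgue"
    and le: "\<And>y. (\<Sum>j\<in>J. ennreal (\<bar>f j y\<bar> powr q)) \<le> ennreal_powr (g y) q"
    and g: "(\<integral>\<^sup>+y. g y \<partial>lebesgue) < \<infinity>"
  shows "(\<Sum>j\<in>J. cell_average r L (\<lambda>y. ennreal \<bar>f j y\<bar>) w powr q) \<le> cell_average r L g w powr q"
proof -
  have [measurable]: "cell r L w \<in> sets lebesgue" by (rule cell_lebesgue)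
  let ?V = "(L / 2 ^ length w) ^ CARD('n)"
  have V: "0 < ?V" using L by simp
  have "(\<Sum>j\<in>J. enn2real (\<integral>\<^sup>+y. ennreal (\<bar>f j y\<bar> * indicator (cell r L w) y) \<partial>lebesgue) powr q)
    \<le> enn2real (\<integral>\<^sup>+y\<in>cell r L w. g y \<partial>lebesgue) powr q"
  proof (rule minkowski_integral[OF q fin])
    show "(\<Sum>j\<in>J. ennreal ((\<bar>f j y\<bar> * indicator (cell r L w) y) powr q))
        \<le> ennreal_powr (g y * indicator (cell r L w) y) q" for y
      using le[of y] q by (auto simp: indicator_def)
    show "(\<integral>\<^sup>+y\<in>cell r L w. g y \<partial>lebesgue) < \<infinity>"
      by (rule le_less_trans[OF nn_integral_mono g]) (auto simp: indicator_def)
  qed auto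
  then have "(\<Sum>j\<in>J. enn2real (\<integral>\<^sup>+y\<in>cell r L w. ennreal \<bar>f j y\<bar> \<partial>lebesgue) powr q) / ?V powr q
    \<le> enn2real (\<integral>\<^sup>+y\<in>cell r L w. g y \<partial>lebesgue) powr q / ?V powr q"
    by (intro divide_right_mono) (auto simp: ennreal_mult ennreal_indicator)
  then show ?thesis
    using V L by (simp add: cell_average_def powr_divide sum_divide_distrib del: power_divide)
qed

text \<open>The cell averages form a vector martingale, unless the average of \<open>g\<close> over the root vanishes; then
Minkowski's inequality makes all averages of the \<open>f j\<close> vanish as well, and no leaf is counted.\<close>
lemma dyadic_tail_bound:
  fixes r :: "real ^ 'n"
  assumes q: "1 < q" and fin: "finite J" and L: "0 < L" and T: "0 \<le> T"
    and meas: "\<And>j. f j \<in> borel_measurable lebesgue" "g \<in> borel_measurable lebesgue"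
    and le: "\<And>y. (\<Sum>j\<in>J. ennreal (\<bar>f j y\<bar> powr q)) \<le> ennreal_powr (g y) q"
    and g: "(\<integral>\<^sup>+y. g y \<partial>lebesgue) < \<infinity>"
    and f: "\<And>j. (\<integral>\<^sup>+y. ennreal \<bar>f j y\<bar> \<partial>lebesgue) < \<infinity>"
  defines "S \<equiv> \<lambda>w. \<Sum>j\<in>J. running_max (cell_average r L (\<lambda>y. ennreal \<bar>f j y\<bar>)) w powr q"
  shows "real (card {w. length w = N \<and> T * running_max (cell_average r L g) w powr q < S w})
    \<le> 2 * exp (- (T / (2 * tree_const (real CARD('n set)) q))) * real CARD('n set) ^ N"
proof (cases "cell_average r L g [] = 0")
  case True
  have g_cell: "(\<integral>\<^sup>+y\<in>cell r L w. g y \<partial>lebesgue) < top" for w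
    by (rule le_less_trans[OF nn_integral_mono g[unfolded infinity_ennreal_def]]) (auto simp: indicator_def)
  have "(\<integral>\<^sup>+y\<in>cell r L []. g y \<partial>lebesgue) = 0"
    using True L g_cell[of "[]"] by (auto simp: cell_average_def enn2real_eq_0_iff)
  moreover have "(\<integral>\<^sup>+y\<in>cell r L w. g y \<partial>lebesgue) \<le> (\<integral>\<^sup>+y\<in>cell r L []. g y \<partial>lebesgue)" for w
    using cell_antimono[OF L, of r w "[]"] by (intro nn_integral_mono) (auto simp: indicator_def)
  ultimately have "cell_average r L g w = 0" for w by (simp add: cell_average_def)
  then have sum0: "(\<Sum>j\<in>J. cell_average r L (\<lambda>y. ennreal \<bar>f j y\<bar>) w powr q) \<le> 0" for w
    using cell_average_minkowski[OF q fin L meas le g, of r w] by simp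
  have "cell_average r L (\<lambda>y. ennreal \<bar>f j y\<bar>) w = 0" if "j \<in> J" for j w
  proof -
    have "cell_average r L (\<lambda>y. ennreal \<bar>f j y\<bar>) w powr q
      \<le> (\<Sum>j\<in>J. cell_average r L (\<lambda>y. ennreal \<bar>f j y\<bar>) w powr q)"
      using that fin by (intro member_le_sum) auto
    moreover have "0 \<le> cell_average r L (\<lambda>y. ennreal \<bar>f j y\<bar>) w powr q" by simp
    ultimately have "cell_average r L (\<lambda>y. ennreal \<bar>f j y\<bar>) w powr q = 0"
      using sum0[of w] by linarith
    then show ?thesis by simp
  qed
  then have "running_max (cell_average r L (\<lambda>y. ennreal \<bar>f j y\<bar>)) w = 0" if "j \<in> J" for j w
    using that by (induction w) auto
  then have "S w = 0" for w by (simp add: S_def)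
  moreover have "0 \<le> T * running_max (cell_average r L g) w powr q" for w using T by simp
  ultimately have none: "{w. length w = N \<and> T * running_max (cell_average r L g) w powr q < S w} = {}"
    by (auto simp: not_less)
  show ?thesis unfolding none by simp
next
  case False
  interpret vector_martingale q J "\<lambda>j. cell_average r L (\<lambda>y. ennreal \<bar>f j y\<bar>)" "cell_average r L g"
  proof
    show "0 < cell_average r L g []"
      using False L by (simp add: cell_average_def less_le)
    show "(\<Sum>j\<in>J. cell_average r L (\<lambda>y. ennreal \<bar>f j y\<bar>) w powr q) \<le> cell_average r L g w powr q" for w
      by (rule cell_average_minkowski[OF q fin L meas le g])
    show "(\<Sum>e\<in>UNIV. cell_average r L (\<lambda>y. ennreal \<bar>f j y\<bar>) (e # w))
        = real CARD('n set) * cell_average r L (\<lambda>y. ennreal \<bar>f j y\<bar>) w" for j w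
      using meas(1)[of j] by (intro cell_average_split L f) measurable
    show "(\<Sum>e\<in>UNIV. cell_average r L g (e # w)) = real CARD('n set) * cell_average r L g w" for w
      by (intro cell_average_split L meas g)
  qed (use q fin L in \<open>auto simp: cell_average_def\<close>)
  show ?thesis using exponential_decay[of N T] unfolding G_def S_def assms .
qed

text \<open>The sums are compared with the full maximal function of \<open>g\<close>, which dominates the running maximum of
the cell averages but, unlike the latter, does not grow with \<open>N\<close>. This is what makes these sets increase
with \<open>N\<close> and with \<open>J\<close>.\<close>
lemma dyadic_level_set_bound:
  fixes r :: "real ^ 'n"
  assumes q: "1 < q" and fin: "finite J" and L: "0 < L" and T: "0 \<le> T"
    and meas: "\<And>j. f j \<in> borel_measurable lebesgue" "g \<in> borel_measurable lebesgue"
    and le: "\<And>y. (\<Sum>j\<in>J. ennreal (\<bar>f j y\<bar> powr q)) \<le> ennreal_powr (g y) q"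
    and g: "(\<integral>\<^sup>+y. g y \<partial>lebesgue) < \<infinity>"
    and f: "\<And>j. (\<integral>\<^sup>+y. ennreal \<bar>f j y\<bar> \<partial>lebesgue) < \<infinity>"
  defines "S \<equiv> \<lambda>w. \<Sum>j\<in>J. running_max (cell_average r L (\<lambda>y. ennreal \<bar>f j y\<bar>)) w powr q"
  shows "emeasure lebesgue (\<Union>w\<in>{w. length w = N}.
      cell r L w \<inter> {x. ennreal T * ennreal_powr (hl_maximal g x) q < ennreal (S w)})
    \<le> ennreal (2 * exp (- (T / (2 * tree_const (real CARD('n set)) q))) * L ^ CARD('n))"
proof -
  define B where "B = {w. length w = N \<and> T * running_max (cell_average r L g) w powr q < S w}"
  have finB: "finite B" unfolding B_def by (rule finite_subset[OF _ finite_words[of N]]) auto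
  have G_le: "ennreal (running_max (cell_average r L g) w) \<le> hl_maximal g x" if "x \<in> cell r L w" for w x
    using that
  proof (induction w)
    case Nil then show ?case using cell_average_le_hl_maximal[OF L _ g] by auto
  next
    case (Cons e w)
    then show ?case
      using cell_average_le_hl_maximal[OF L Cons.prems g] cell_Cons_iff[OF L, of x r e w] by (simp add: max_def)
  qed
  have nonneg: "0 \<le> running_max (cell_average r L g) w" for w
    by (rule order_trans[OF _ running_max_ge]) (use L in \<open>simp add: cell_average_def\<close>)
  have sub: "(\<Union>w\<in>{w. length w = N}.
      cell r L w \<inter> {x. ennreal T * ennreal_powr (hl_maximal g x) q < ennreal (S w)}) \<subseteq> (\<Union>w\<in>B. cell r L w)"
  proof clarify
    fix x w assume w: "N = length w" "x \<in> cell r L w"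
      and lt: "ennreal T * ennreal_powr (hl_maximal g x) q < ennreal (S w)"
    have "ennreal (T * running_max (cell_average r L g) w powr q)
        = ennreal T * ennreal_powr (ennreal (running_max (cell_average r L g) w)) q"
      using T nonneg by (simp add: ennreal_powr_ennreal ennreal_mult)
    also have "\<dots> \<le> ennreal T * ennreal_powr (hl_maximal g x) q"
      using q by (intro mult_left_mono ennreal_powr_mono G_le w) auto
    also note lt
    finally have "T * running_max (cell_average r L g) w powr q < S w"
      using T by (simp add: ennreal_less_iff)
    then show "x \<in> (\<Union>w\<in>B. cell r L w)" using w by (auto simp: B_def)
  qed
  have "emeasure lebesgue (\<Union>w\<in>{w. length w = N}.
      cell r L w \<inter> {x. ennreal T * ennreal_powr (hl_maximal g x) q < ennreal (S w)})
    \<le> emeasure lebesgue (\<Union>w\<in>B. cell r L w)"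
    using finB by (intro emeasure_mono sub) (auto intro!: cell_lebesgue)
  also have "\<dots> \<le> (\<Sum>w\<in>B. emeasure lebesgue (cell r L w))"
    using finB by (intro emeasure_subadditive_finite) (auto intro: cell_lebesgue)
  also have "\<dots> = (\<Sum>w\<in>B. ennreal ((L / 2 ^ N) ^ CARD('n)))"
    using L by (intro sum.cong refl) (simp only: emeasure_cell, simp add: B_def)
  also have "\<dots> = ennreal (real (card B) * (L / 2 ^ N) ^ CARD('n))"
    using L by (subst sum_ennreal) auto
  also have "\<dots> \<le> ennreal (2 * exp (- (T / (2 * tree_const (real CARD('n set)) q)))
      * real CARD('n set) ^ N * (L / 2 ^ N) ^ CARD('n))"
    using dyadic_tail_bound[OF q fin L T meas le g f, where N = N and r = r] L
    by (intro ennreal_leI mult_right_mono) (auto simp: B_def S_def)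
  also have "real CARD('n set) ^ N * (L / 2 ^ N) ^ CARD('n) = L ^ CARD('n)"
    by (simp add: card_UNIV_set power_divide power_mult[symmetric] mult.commute)
  then have "2 * exp (- (T / (2 * tree_const (real CARD('n set)) q)))
      * real CARD('n set) ^ N * (L / 2 ^ N) ^ CARD('n)
    = 2 * exp (- (T / (2 * tree_const (real CARD('n set)) q))) * L ^ CARD('n)"
    by (simp only: mult.assoc)
  finally show ?thesis .
qed

section \<open>All functions and all cubes\<close>

lemma sum_le_vec_abs_powr:
  assumes "1 < q" "finite J"
  shows "(\<Sum>j\<in>J. ennreal (\<bar>f j y\<bar> powr q)) \<le> ennreal_powr (vec_abs q f y) q"
proof -
  have "(\<Sum>j\<in>J. ennreal (\<bar>f j y\<bar> powr q)) = (\<Sum>j\<in>J. ennreal_powr (ennreal \<bar>f j y\<bar>) q)"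
    by (simp add: ennreal_powr_ennreal)
  also have "\<dots> \<le> (\<Sum>j. ennreal_powr (ennreal \<bar>f j y\<bar>) q)"
    using assms by (intro sum_le_suminf) auto
  also have "\<dots> = ennreal_powr (vec_abs q f y) q"
    using assms by (simp add: vec_abs_def lq_norm_def ennreal_powr_inverse')
  finally show ?thesis .
qed

lemma abs_le_vec_abs:
  assumes "1 < q"
  shows "ennreal \<bar>f j y\<bar> \<le> vec_abs q f y"
proof -
  have "ennreal_powr (ennreal \<bar>f j y\<bar>) q \<le> ennreal_powr (vec_abs q f y) q"
    using sum_le_vec_abs_powr[OF assms, of "{j}" f y] by (simp add: ennreal_powr_ennreal)
  then show ?thesis using assms by (simp add: ennreal_powr_le_iff ennreal_powr_inverse)
qed

text \<open>By monotonicity, the diagonal bound, with the same \<open>i\<close> for the depth and for the number of terms,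
controls all finite sums at all depths.\<close>
lemma ennreal_suminf_SUP_le:
  fixes u :: "nat \<Rightarrow> nat \<Rightarrow> ennreal"
  assumes mono: "\<And>j. incseq (\<lambda>i. u i j)" and le: "\<And>i. (\<Sum>j<i. u i j) \<le> C"
  shows "(\<Sum>j. SUP i. u i j) \<le> C"
proof -
  have "(\<Sum>j<n. SUP i. u i j) \<le> C" for n
  proof -
    have "(\<Sum>j<n. SUP i. u i j) = (SUP i. \<Sum>j<n. u i j)"
      by (rule ennreal_SUP_sum[symmetric]) (rule mono)
    also have "\<dots> \<le> C"
    proof (rule SUP_least)
      fix i
      have "(\<Sum>j<n. u i j) \<le> (\<Sum>j<n. u (max n i) j)"
        by (intro sum_mono incseqD[OF mono]) simp
      also have "\<dots> \<le> (\<Sum>j<max n i. u (max n i) j)" by (intro sum_mono2) auto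
      also have "\<dots> \<le> C" by (rule le)
      finally show "(\<Sum>j<n. u i j) \<le> C" .
    qed
    finally show ?thesis .
  qed
  then show ?thesis unfolding suminf_eq_SUP by (intro SUP_least)
qed

text \<open>At \<open>x\<close>, the \<open>q\<close>-th power of \<open>M f\<^sub>j\<close> is at most \<open>6\<^sup>n\<^sup>q\<close> times the supremum over the depth of the sum, over
the \<open>2\<^sup>n\<close> shifts, of the \<open>q\<close>-th powers of the dyadic running maxima. Replacing the maximum over the shifts
by their sum costs the factor \<open>2\<^sup>n\<close>.\<close>
lemma vec_maximal_powr_le:
  fixes a :: "real ^ 'n" and f :: "nat \<Rightarrow> real ^ 'n \<Rightarrow> real"
  assumes q: "1 < q" and l: "0 < l" and x: "x \<in> cbox a (\<chi> i. a $ i + l)"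
    and supp: "\<And>j y. y \<notin> cbox a (\<chi> i. a $ i + l) \<Longrightarrow> f j y = 0"
    and fin: "\<And>j. (\<integral>\<^sup>+y. ennreal \<bar>f j y\<bar> \<partial>lebesgue) < \<infinity>"
    and le: "\<And>s i w. length w = i \<Longrightarrow> x \<in> cell (shifted_root a l s) (3 * l) w \<Longrightarrow>
      ennreal (\<Sum>j<i. running_max (cell_average (shifted_root a l s) (3 * l) (\<lambda>y. ennreal \<bar>f j y\<bar>)) w powr q) \<le> C"
  shows "(\<Sum>j. ennreal_powr (hl_maximal (\<lambda>y. ennreal \<bar>f j y\<bar>) x) q)
    \<le> ennreal ((6 ^ CARD('n)) powr q * 2 ^ CARD('n)) * C"
proof -
  define A where "A s j = cell_average (shifted_root a l s) (3 * l) (\<lambda>y. ennreal \<bar>f j y\<bar>)" for s j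
  define w where "w s i = address (shifted_root a l s) (3 * l) x i" for s i
  define u where "u i j = (\<Sum>s\<in>UNIV. ennreal (running_max (A s j) (w s i) powr q))" for i j
  define K where "K = (6 ^ CARD('n)) powr q"
  have A: "0 \<le> A s j v" for s j v using l by (simp add: A_def cell_average_def)
  have R: "0 \<le> running_max (A s j) v" for s j v
    using A running_max_ge[of "A s j" v] order_trans by blast
  have xw: "x \<in> cell (shifted_root a l s) (3 * l) (w s i)" for s i
    unfolding w_def using l x cube_subset_shifted_root_cell[OF l, of a s] by (intro in_cell_address) auto
  have mono: "incseq (\<lambda>i. u i j)" for j
    unfolding u_def w_def
    by (intro incseq_SucI sum_mono ennreal_leI powr_mono2) (use q R in auto)
  have max_le: "ennreal_powr (hl_maximal (\<lambda>y. ennreal \<bar>f j y\<bar>) x) q \<le> ennreal K * (SUP i. u i j)" for j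
  proof -
    have "hl_maximal (\<lambda>y. ennreal \<bar>f j y\<bar>) x \<le> ennreal_powr (ennreal K * (SUP i. u i j)) (1 / q)"
    proof (rule hl_maximal_le_shifted_cells[OF l x])
      fix s v assume v: "x \<in> cell (shifted_root a l s) (3 * l) v"
      have wv: "w s (length v) = v" unfolding w_def using l v by (intro address_unique) auto
      have "ennreal_powr (ennreal (6 ^ CARD('n) * A s j v)) q = ennreal K * ennreal (A s j v powr q)"
        using A by (subst ennreal_powr_ennreal) (auto simp: powr_mult K_def ennreal_mult)
      also have "ennreal (A s j v powr q) \<le> ennreal (running_max (A s j) (w s (length v)) powr q)"
        unfolding wv using q A running_max_ge by (intro ennreal_leI powr_mono2) auto
      also have "\<dots> \<le> u (length v) j"
        unfolding u_def by (rule member_le_sum) auto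
      also have "\<dots> \<le> (SUP i. u i j)" by (rule SUP_upper) simp
      finally show "ennreal (6 ^ CARD('n) * cell_average (shifted_root a l s) (3 * l) (\<lambda>y. ennreal \<bar>f j y\<bar>) v)
          \<le> ennreal_powr (ennreal K * (SUP i. u i j)) (1 / q)"
        using q by (simp add: ennreal_powr_le_iff A_def mult_left_mono)
    qed (use supp fin in auto)
    then show ?thesis using q by (simp add: ennreal_powr_le_iff)
  qed
  have "(\<Sum>j<i. u i j) \<le> 2 ^ CARD('n) * C" for i
  proof -
    have "(\<Sum>j<i. u i j) = (\<Sum>s\<in>UNIV. ennreal (\<Sum>j<i. running_max (A s j) (w s i) powr q))"
      unfolding u_def by (subst sum.swap) simp
    also have "\<dots> \<le> (\<Sum>s\<in>(UNIV :: 'n set set). C)"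
      using le[OF _ xw] by (intro sum_mono) (simp add: A_def w_def)
    also have "\<dots> = 2 ^ CARD('n) * C" by (simp add: card_UNIV_set)
    finally show ?thesis .
  qed
  then have "(\<Sum>j. SUP i. u i j) \<le> 2 ^ CARD('n) * C" by (rule ennreal_suminf_SUP_le[OF mono])
  then have "ennreal K * (\<Sum>j. SUP i. u i j) \<le> ennreal K * (2 ^ CARD('n) * C)"
    by (rule mult_left_mono) simp
  moreover have "(\<Sum>j. ennreal_powr (hl_maximal (\<lambda>y. ennreal \<bar>f j y\<bar>) x) q)
      \<le> (\<Sum>j. ennreal K * (SUP i. u i j))"
    by (intro suminf_le max_le) auto
  ultimately show ?thesis
    by (simp add: K_def ennreal_mult ennreal_power[symmetric] mult.assoc)
qed

text \<open>If \<open>x\<close> is in none of the level sets \<open>B s i\<close> for the threshold \<open>T = t\<^sup>q / K\<close>, where \<open>K = 6\<^sup>n\<^sup>q 2\<^sup>n\<close>, then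
\<open>vec_maximal_powr_le\<close> keeps \<open>x\<close> out of the level set in question. Each union over \<open>i\<close> is increasing and
inherits the bound for finite depth. The factor \<open>6\<^sup>n\<close> is the number \<open>2\<^sup>n\<close> of trees times the volume ratio
\<open>3\<^sup>n\<close> of their roots to the cube.\<close>
lemma level_set_emeasure_le:
  fixes a :: "real ^ 'n" and f :: "nat \<Rightarrow> real ^ 'n \<Rightarrow> real"
  assumes q: "1 < q" and l: "0 < l" and t: "0 < t"
    and supp: "\<And>j y. y \<notin> cbox a (\<chi> i. a $ i + l) \<Longrightarrow> f j y = 0"
    and meas: "\<And>j. f j \<in> borel_measurable lebesgue"
    and fin: "(\<integral>\<^sup>+y. vec_abs q f y \<partial>lebesgue) < \<infinity>"
  defines "K \<equiv> (6 ^ CARD('n)) powr q * 2 ^ CARD('n)"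
  shows "emeasure lebesgue {x \<in> cbox a (\<chi> i. a $ i + l).
      ennreal t * hl_maximal (vec_abs q f) x < vec_maximal q f x}
    \<le> ennreal (2 * 6 ^ CARD('n) * exp (- (t powr q / (2 * K * tree_const (real CARD('n set)) q))) * l ^ CARD('n))"
proof -
  define T where "T = t powr q / K"
  have K: "0 < K" by (simp add: K_def)
  have T: "0 \<le> T" "K * T = t powr q" using K by (auto simp: T_def)
  define S where "S s i w = (\<Sum>j<i. running_max (cell_average (shifted_root a l s) (3 * l)
      (\<lambda>y. ennreal \<bar>f j y\<bar>)) w powr q)" for s i w
  define B where "B s i = (\<Union>w\<in>{w. length w = i}. cell (shifted_root a l s) (3 * l) w \<inter>
      {x. ennreal T * ennreal_powr (hl_maximal (vec_abs q f) x) q < ennreal (S s i w)})" for s i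
  let ?b = "2 * exp (- (T / (2 * tree_const (real CARD('n set)) q))) * (3 * l) ^ CARD('n)"
  have [measurable]: "vec_abs q f \<in> borel_measurable lebesgue"
    unfolding vec_abs_def using meas by measurable
  note [measurable] = hl_maximal_measurable[of "vec_abs q f"]
  have fin_f: "(\<integral>\<^sup>+y. ennreal \<bar>f j y\<bar> \<partial>lebesgue) < \<infinity>" for j
    by (rule le_less_trans[OF nn_integral_mono fin]) (rule abs_le_vec_abs[OF q])
  have B_sets: "B s i \<in> sets lebesgue" for s i
    unfolding B_def
  proof (intro sets.finite_UN finite_words sets.Int cell_lebesgue)
    fix w
    have "{x \<in> space lebesgue. ennreal T * ennreal_powr (hl_maximal (vec_abs q f) x) q < ennreal (S s i w)}
        \<in> sets lebesgue"
      by measurable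
    then show "{x. ennreal T * ennreal_powr (hl_maximal (vec_abs q f) x) q < ennreal (S s i w)} \<in> sets lebesgue"
      by simp
  qed
  have B_le: "emeasure lebesgue (B s i) \<le> ennreal ?b" for s i
    unfolding B_def S_def
    using l q T by (intro dyadic_level_set_bound meas fin fin_f sum_le_vec_abs_powr) auto
  have B_inc: "incseq (B s)" for s
  proof (rule incseq_SucI, rule subsetI)
    fix i x assume "x \<in> B s i"
    then obtain w where w: "length w = i" "x \<in> cell (shifted_root a l s) (3 * l) w"
      and lt: "ennreal T * ennreal_powr (hl_maximal (vec_abs q f) x) q < ennreal (S s i w)"
      by (auto simp: B_def)
    define e where "e = {k. corner (shifted_root a l s) (3 * l) w $ k + 3 * l / 2 ^ Suc (length w) \<le> x $ k}"
    have xe: "x \<in> cell (shifted_root a l s) (3 * l) (e # w)"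
      using w l by (simp add: cell_Cons_iff e_def)
    have nonneg: "0 \<le> running_max (cell_average (shifted_root a l s) (3 * l) (\<lambda>y. ennreal \<bar>f j y\<bar>)) w" for j
      by (rule order_trans[OF _ running_max_ge]) (use l in \<open>simp add: cell_average_def\<close>)
    have "S s i w \<le> S s i (e # w)"
      unfolding S_def using q nonneg by (intro sum_mono powr_mono2) auto
    also have "\<dots> \<le> S s (Suc i) (e # w)" unfolding S_def by simp
    finally have "ennreal T * ennreal_powr (hl_maximal (vec_abs q f) x) q < ennreal (S s (Suc i) (e # w))"
      using lt by (meson ennreal_leI less_le_trans)
    then show "x \<in> B s (Suc i)" using xe w unfolding B_def by (intro UN_I[of "e # w"]) auto
  qed
  have "{x \<in> cbox a (\<chi> i. a $ i + l). ennreal t * hl_maximal (vec_abs q f) x < vec_maximal q f x}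
      \<subseteq> (\<Union>s\<in>UNIV. \<Union>i. B s i)"
  proof (rule subsetI, rule ccontr)
    fix x assume "x \<in> {x \<in> cbox a (\<chi> i. a $ i + l). ennreal t * hl_maximal (vec_abs q f) x < vec_maximal q f x}"
    then have x: "x \<in> cbox a (\<chi> i. a $ i + l)"
      and lt: "ennreal t * hl_maximal (vec_abs q f) x < vec_maximal q f x" by auto
    assume "x \<notin> (\<Union>s\<in>UNIV. \<Union>i. B s i)"
    then have S_le: "ennreal (S s i w) \<le> ennreal T * ennreal_powr (hl_maximal (vec_abs q f) x) q"
      if "length w = i" "x \<in> cell (shifted_root a l s) (3 * l) w" for s i w
      using that by (force simp: B_def not_less)
    have "(\<Sum>j. ennreal_powr (hl_maximal (\<lambda>y. ennreal \<bar>f j y\<bar>) x) q)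
        \<le> ennreal K * (ennreal T * ennreal_powr (hl_maximal (vec_abs q f) x) q)"
      unfolding K_def by (rule vec_maximal_powr_le[OF q l x supp fin_f S_le[unfolded S_def]])
    also have "\<dots> = ennreal (t powr q) * ennreal_powr (hl_maximal (vec_abs q f) x) q"
      using K T by (simp add: mult.assoc[symmetric] ennreal_mult[symmetric])
    also have "\<dots> = ennreal_powr (ennreal t * hl_maximal (vec_abs q f) x) q"
      using t by (simp add: ennreal_powr_cmult)
    finally have "vec_maximal q f x \<le> ennreal t * hl_maximal (vec_abs q f) x"
      unfolding vec_maximal_def lq_norm_def using q by (subst ennreal_powr_le_iff) auto
    with lt show False by simp
  qed
  then have "emeasure lebesgue {x \<in> cbox a (\<chi> i. a $ i + l).
      ennreal t * hl_maximal (vec_abs q f) x < vec_maximal q f x}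
    \<le> emeasure lebesgue (\<Union>s\<in>UNIV. \<Union>i. B s i)"
    by (rule emeasure_mono) (use B_sets in auto)
  also have "\<dots> \<le> (\<Sum>s\<in>UNIV. emeasure lebesgue (\<Union>i. B s i))"
    by (rule emeasure_subadditive_finite) (use B_sets in auto)
  also have "\<dots> \<le> (\<Sum>s\<in>(UNIV :: 'n set set). ennreal ?b)"
  proof (rule sum_mono)
    fix s
    have "emeasure lebesgue (\<Union>i. B s i) = (SUP i. emeasure lebesgue (B s i))"
      by (rule SUP_emeasure_incseq[symmetric]) (use B_sets B_inc in auto)
    also have "\<dots> \<le> ennreal ?b" by (intro SUP_least B_le)
    finally show "emeasure lebesgue (\<Union>i. B s i) \<le> ennreal ?b" .
  qed
  also have "\<dots> = ennreal (real CARD('n set) * ?b)" using l by (subst sum_ennreal) auto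
  also have "real CARD('n set) * ?b
    = 2 * 6 ^ CARD('n) * exp (- (t powr q / (2 * K * tree_const (real CARD('n set)) q))) * l ^ CARD('n)"
  proof -
    have "(6 :: real) ^ CARD('n) = 2 ^ CARD('n) * 3 ^ CARD('n)"
      by (simp add: power_mult_distrib[symmetric])
    then show ?thesis by (simp add: T_def card_UNIV_set power_mult_distrib mult_ac)
  qed
  finally show ?thesis .
qed

theorem theorem2p5:
  fixes q :: real
  assumes "1 < q"
  shows "\<exists>\<alpha> c :: real. 0 < \<alpha> \<and> 0 < c \<and>
    (\<forall>(Q :: (real ^ 'n) set) (f :: nat \<Rightarrow> real ^ 'n \<Rightarrow> real).
       is_cube Q \<longrightarrow>
       (\<forall>j. locally_integrable (f j)) \<longrightarrow>
       (\<forall>j. closure {x. f j x \<noteq> 0} \<subseteq> Q) \<longrightarrow>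
       (\<forall>t>0.
          {x \<in> Q. vec_maximal q f x > ennreal t * hl_maximal (vec_abs q f) x} \<in> lmeasurable \<and>
          measure lebesgue {x \<in> Q. vec_maximal q f x > ennreal t * hl_maximal (vec_abs q f) x}
            \<le> c * exp (- \<alpha> * t powr q) * measure lebesgue Q))"
proof -
  define K where "K = (6 ^ CARD('n)) powr q * 2 ^ CARD('n)"
  define \<alpha> where "\<alpha> = 1 / (2 * K * tree_const (real CARD('n set)) q)"
  define c :: real where "c = 2 * 6 ^ CARD('n)"
  have "0 < tree_const (real CARD('n set)) q" using assms by (intro tree_const_pos) auto
  then have \<alpha>: "0 < \<alpha>" by (simp add: \<alpha>_def K_def)
  have c: "0 < c" by (simp add: c_def)
  show ?thesis
  proof (rule exI[of _ \<alpha>], rule exI[of _ c], intro conjI \<alpha> c allI impI)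
    fix Q :: "(real ^ 'n) set" and f :: "nat \<Rightarrow> real ^ 'n \<Rightarrow> real" and t :: real
    assume Q: "is_cube Q" and loc: "\<forall>j. locally_integrable (f j)"
      and cl: "\<forall>j. closure {x. f j x \<noteq> 0} \<subseteq> Q" and t: "0 < t"
    let ?X = "{x \<in> Q. vec_maximal q f x > ennreal t * hl_maximal (vec_abs q f) x}"
    obtain a l where l: "0 < l" and Q_def: "Q = cbox a (\<chi> i. a $ i + l)"
      using Q by (auto simp: is_cube_def)
    have supp: "f j y = 0" if "y \<notin> Q" for j y
      using cl closure_subset[of "{x. f j x \<noteq> 0}"] that by blast
    have meas: "f j \<in> borel_measurable lebesgue" for j
    proof -
      have "set_integrable lebesgue Q (f j)"
        using loc by (auto simp: locally_integrable_def Q_def)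
      then have "(\<lambda>x. indicator Q x *\<^sub>R f j x) \<in> borel_measurable lebesgue"
        by (auto simp: set_integrable_def)
      also have "(\<lambda>x. indicator Q x *\<^sub>R f j x) = f j"
        using supp by (auto simp: indicator_def fun_eq_iff)
      finally show ?thesis .
    qed
    have [measurable]: "vec_maximal q f \<in> borel_measurable lebesgue"
      unfolding vec_maximal_def using hl_maximal_measurable by measurable
    note [measurable] = hl_maximal_measurable[of "vec_abs q f"]
    have Q_lmeas: "Q \<in> lmeasurable" by (simp add: Q_def)
    have "{x \<in> space lebesgue. vec_maximal q f x > ennreal t * hl_maximal (vec_abs q f) x} \<in> sets lebesgue"
      by measurable
    then have "Q \<inter> {x. vec_maximal q f x > ennreal t * hl_maximal (vec_abs q f) x} \<in> lmeasurable"
      using Q_lmeas by (intro fmeasurable_Int_fmeasurable) auto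
    then show X: "?X \<in> lmeasurable" by (simp add: Collect_conj_eq)
    have Q_measure: "measure lebesgue Q = l ^ CARD('n)"
      using l by (simp add: measure_def Q_def emeasure_cube)
    show "measure lebesgue ?X \<le> c * exp (- \<alpha> * t powr q) * measure lebesgue Q"
    proof (cases "(\<integral>\<^sup>+y. vec_abs q f y \<partial>lebesgue) < \<infinity>")
      case True
      have "emeasure lebesgue ?X \<le> ennreal (c * exp (- \<alpha> * t powr q) * l ^ CARD('n))"
        using level_set_emeasure_le[OF assms l t _ meas True] supp unfolding Q_def
        by (simp add: \<alpha>_def c_def K_def)
      then show ?thesis
        using X c l by (simp add: emeasure_eq_measure2 Q_measure)
    next
      case False
      have zero: "vec_abs q f y = 0" if "y \<notin> Q" for y
        using supp[OF that] assms by (simp add: vec_abs_def lq_norm_def ennreal_powr_def)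
      have "(\<integral>\<^sup>+y\<in>Q. vec_abs q f y \<partial>lebesgue) = (\<integral>\<^sup>+y. vec_abs q f y \<partial>lebesgue)"
        using zero by (intro nn_integral_cong) (auto simp: indicator_def)
      then have top: "(\<integral>\<^sup>+y\<in>Q. vec_abs q f y \<partial>lebesgue) = top"
        using False by (simp add: less_top[symmetric])
      have "hl_maximal (vec_abs q f) x = top" if "x \<in> Q" for x
        using hl_maximal_ge[OF l, of x a "vec_abs q f"] that top
        by (simp add: Q_def ennreal_top_divide top_unique)
      then have empty: "?X = {}" using t by (auto simp: ennreal_mult_top)
      show ?thesis unfolding empty using c by simp
    qed
  qed
qed

end
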